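(* Suppose $\mathcal{B}$ is a non-trivial approximation algorithm for the Robust $\mathscr{F}$-Supplier problem that runs in time $T_{\mathcal{B}}(|\mathscr{I}|)$ on instance $\mathscr{I}$. Then any $\mathscr{F}$-PCM instance $\mathscr{J}=(F,\mathscr{F},\mathscr{P},\mathsf{val})$ can be solved in time $\mathrm{poly}(|\mathscr{J}|)\,T_{\mathcal{B}}(|\mathscr{I}|)$, where $|\mathscr{I}|=\mathrm{poly}(|\mathscr{J}|)$.
   Context: Robust $\mathscr{F}$-Supplier problem: the input $\mathscr{I}=(F,C,d,m,\mathscr{F})$ consists of a finite set $X=F\cup C$ with a metric $d$ (distances may be taken in $\mathbb{R}_{\ge0}\cup\{\infty\}$), a down-closed family $\mathscr{F}\subseteq 2^F$, and an integer $m\in\{0,\dots,|C|\}$; with $d(v,S)=\min_{u\in S}d(v,u)$, the goal is to find $S\in\mathscr{F}$ and $T\subseteq C$ with $|T|\ge m$ minimizing $\max_{u\in T}d(u,S)$, with optimum $\mathsf{opt}(\mathscr{I})$. A non-trivial approximation algorithm is one that, for some finite factor $\alpha\ge1$, always returns $S\in\mathscr{F}$ and $T\subseteq C$ with $|T|\ge m$ and $\max_{u\in T}d(u,S)\le\alpha\,\mathsf{opt}(\mathscr{I})$. $\mathscr{F}$-PCM problem: input $\mathscr{J}=(F,\mathscr{F},\mathscr{P},\mathsf{val})$ with $\mathscr{F}\subseteq 2^F$ down-closed, $\mathscr{P}$ a sub-partition of $F$ (pairwise disjoint subsets of $F$), and $\mathsf{val}:F\to\{0,1,2,\dots\}$ constant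 on each part of $\mathscr{P}$ and poly-bounded (its maximum value is at most a polynomial in $|F|$); the goal is to find $S\in\mathscr{F}$ with $|S\cap A|\le1$ for all $A\in\mathscr{P}$ maximizing $\mathsf{val}(S)=\sum_{f\in S}\mathsf{val}(f)$. *)

theory Defs
  imports
    "HOL-Library.Extended_Nonnegative_Real"
    "HOL-Computational_Algebra.Polynomial"
begin

section \<open>Machine model\<close>

text \<open>
  Algorithms are programs of a small deterministic language that computes with binary trees, in the
  style of the WHILE language of Jones (Computability and Complexity from a Programming
  Perspective). A program maps a tree to a tree. Trees are immutable, so the basic operations are
  constant-time pointer operations on shared trees, and the number of steps is polynomially
  related to the running time of a Turing machine. In addition a program may put yes/no questions
  to an oracle; a question costs its size as a tree, so that questions must be written out in full.
\<close>

datatype tree = Leaf | Node tree tree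

datatype prog =
    Const_Leaf
  | Ident
  | Left
  | Right
  | Pair prog prog
  | Seq prog prog
  | Cond prog prog prog
  | While prog prog
  | Query

fun left :: "tree \<Rightarrow> tree" where
  "left Leaf = Leaf"
| "left (Node a b) = a"

fun right :: "tree \<Rightarrow> tree" where
  "right Leaf = Leaf"
| "right (Node a b) = b"

definition enc_bool :: "bool \<Rightarrow> tree" where
  "enc_bool b = (if b then Node Leaf Leaf else Leaf)"

text \<open>
  \<open>runs Q p x y t\<close>: with oracle \<open>Q\<close>, program \<open>p\<close> halts on input \<open>x\<close> with output \<open>y\<close> after
  \<open>t\<close> steps. As a condition, \<open>Leaf\<close> counts as false and every other tree as true.
\<close>

inductive runs :: "(tree \<Rightarrow> bool) \<Rightarrow> prog \<Rightarrow> tree \<Rightarrow> tree \<Rightarrow> nat \<Rightarrow> bool"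
  for Q :: "tree \<Rightarrow> bool" where
  Const_Leaf: "runs Q Const_Leaf x Leaf 1"
| Ident: "runs Q Ident x x 1"
| Left: "runs Q Left x (left x) 1"
| Right: "runs Q Right x (right x) 1"
| Pair: "runs Q p x y s \<Longrightarrow> runs Q q x z t \<Longrightarrow> runs Q (Pair p q) x (Node y z) (s + t + 1)"
| Seq: "runs Q p x y s \<Longrightarrow> runs Q q y z t \<Longrightarrow> runs Q (Seq p q) x z (s + t + 1)"
| Cond_True: "runs Q c x b s \<Longrightarrow> b \<noteq> Leaf \<Longrightarrow> runs Q p x y t \<Longrightarrow> runs Q (Cond c p q) x y (s + t + 1)"
| Cond_False: "runs Q c x Leaf s \<Longrightarrow> runs Q q x y t \<Longrightarrow> runs Q (Cond c p q) x y (s + t + 1)"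
| While_True: "runs Q c x b s \<Longrightarrow> b \<noteq> Leaf \<Longrightarrow> runs Q p x y t \<Longrightarrow> runs Q (While c p) y z u \<Longrightarrow>
    runs Q (While c p) x z (s + t + u + 1)"
| While_False: "runs Q c x Leaf s \<Longrightarrow> runs Q (While c p) x x (s + 1)"
| Query: "runs Q Query x (enc_bool (Q x)) (size x + 1)"

lemma runs_deterministic:
  "runs Q p x y t \<Longrightarrow> runs Q p x y' t' \<Longrightarrow> y' = y \<and> t' = t"
proof (induction arbitrary: y' t' rule: runs.induct)
  case (Const_Leaf x)
  from Const_Leaf.prems show ?case
    by cases auto
next
  case (Ident x)
  from Ident.prems show ?case
    by cases auto
next
  case (Left x)
  from Left.prems show ?case
    by cases auto
next
  case (Right x)
  from Right.prems show ?case
    by cases auto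
next
  case (Pair p x y s q z t)
  from Pair.prems show ?case
    by cases (auto dest!: Pair.IH)
next
  case (Seq p x y s q z t)
  from Seq.prems show ?case
    by cases (auto dest!: Seq.IH)
next
  case (Cond_True c x b s p y t q)
  from Cond_True.prems show ?case
    by cases (auto dest!: Cond_True.IH simp: Cond_True.hyps)
next
  case (Cond_False c x s q y t p)
  from Cond_False.prems show ?case
    by cases (auto dest!: Cond_False.IH)
next
  case (While_True c x b s p y t z u)
  from While_True.prems show ?case
    by cases (auto dest!: While_True.IH simp: While_True.hyps)
next
  case (While_False c x s p)
  from While_False.prems show ?case
    by cases (auto dest!: While_False.IH)
next
  case (Query x)
  from Query.prems show ?case
    by cases auto
qed


section \<open>Encoding of data as trees\<close>

text \<open>Natural numbers are encoded in binary, least significant bit first.\<close>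

fun enc_nat :: "nat \<Rightarrow> tree" where
  "enc_nat n = (if n = 0 then Leaf else Node (enc_bool (odd n)) (enc_nat (n div 2)))"

declare enc_nat.simps [simp del]

definition enc_list :: "('a \<Rightarrow> tree) \<Rightarrow> 'a list \<Rightarrow> tree" where
  "enc_list e xs = foldr (\<lambda>x. Node (e x)) xs Leaf"

text \<open>A finite set of numbers is encoded by any list of its elements without repetitions.\<close>

definition encodes_set :: "tree \<Rightarrow> nat set \<Rightarrow> bool" where
  "encodes_set t S \<longleftrightarrow> (\<exists>xs. distinct xs \<and> set xs = S \<and> t = enc_list enc_nat xs)"

text \<open>
  Input distances are nonnegative rationals or infinite (\<open>None\<close>); a rational is encoded by its
  numerator and denominator in lowest terms.
\<close>

fun enc_dist :: "rat option \<Rightarrow> tree" where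
  "enc_dist None = Leaf"
| "enc_dist (Some q) =
    Node (enc_nat (nat (fst (quotient_of q)))) (enc_nat (nat (snd (quotient_of q))))"

lemma enc_nat_inject [simp]: "enc_nat m = enc_nat n \<longleftrightarrow> m = n"
proof
  show "m = n" if "enc_nat m = enc_nat n"
    using that
  proof (induction m arbitrary: n rule: less_induct)
    case (less m)
    show ?case
    proof (cases "m = 0 \<or> n = 0")
      case True
      with less.prems show ?thesis
        using enc_nat.simps[of m] enc_nat.simps[of n] by (auto split: if_splits)
    next
      case False
      then have "Node (enc_bool (odd m)) (enc_nat (m div 2)) =
          Node (enc_bool (odd n)) (enc_nat (n div 2))"
        using less.prems enc_nat.simps[of m] enc_nat.simps[of n] by simp
      then have "enc_bool (odd m) = enc_bool (odd n)" and "m div 2 = n div 2"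
        using less.IH[of "m div 2" "n div 2"] False by auto
      moreover from this have "odd m = odd n"
        by (simp add: enc_bool_def split: if_splits)
      ultimately show ?thesis
        by (metis even_two_times_div_two odd_two_times_div_two_succ)
    qed
  qed
qed simp

lemma enc_dist_inject:
  assumes "\<And>q. a = Some q \<Longrightarrow> q \<ge> 0" and "\<And>q. b = Some q \<Longrightarrow> q \<ge> 0"
  shows "enc_dist a = enc_dist b \<longleftrightarrow> a = b"
proof (cases a; cases b)
  fix p q assume ab: "a = Some p" "b = Some q"
  have num: "fst (quotient_of r) \<ge> 0" if "r \<ge> 0" for r
  proof -
    obtain n d where nd: "quotient_of r = (n, d)" by fastforce
    then have "d > 0" "r = of_int n / of_int d"
      by (auto simp: quotient_of_denom_pos quotient_of_div)
    with that have "n \<ge> 0" by (simp add: zero_le_divide_iff)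
    with nd show ?thesis by simp
  qed
  have "enc_dist a = enc_dist b \<longleftrightarrow> quotient_of p = quotient_of q"
    using ab assms num[of p] num[of q] quotient_of_denom_pos'[of p] quotient_of_denom_pos'[of q]
    by (auto simp: prod_eq_iff eq_nat_nat_iff)
  also have "\<dots> \<longleftrightarrow> a = b"
    using ab by (simp add: quotient_of_inject_eq)
  finally show ?thesis .
qed auto


section \<open>Set families and their representation\<close>

text \<open>
  The family of feasible facility sets is in general far too large to be listed. How it is presented
  to an algorithm is left arbitrary: \<open>sets_of R r\<close> is the family named by \<open>r\<close>, \<open>description R r\<close>
  is the part of the presentation that is written into the input (and counts for its size), and
  \<open>reply R r\<close> is the oracle available to algorithms working on this family. The choice
  \<open>reply R r = (\<lambda>_. False)\<close> gives explicit or succinct descriptions without an oracle; the choice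
  \<open>description R r = Leaf\<close>, with \<open>reply R r\<close> deciding membership of encoded sets, gives families
  accessible only through a membership oracle.
\<close>

record 'r representation =
  sets_of :: "'r \<Rightarrow> nat set set"
  description :: "'r \<Rightarrow> tree"
  reply :: "'r \<Rightarrow> tree \<Rightarrow> bool"

record 'r set_system =
  facilities :: "nat list"
  family :: 'r

abbreviation facility_set :: "('r, 'b) set_system_scheme \<Rightarrow> nat set" where
  "facility_set I \<equiv> set (facilities I)"

text \<open>
  The family is required to be nonempty (equivalently, to contain the empty set): otherwise there is
  no solution that an algorithm could return.
\<close>

definition down_closed_system :: "'r representation \<Rightarrow> ('r, 'b) set_system_scheme \<Rightarrow> bool" where
  "down_closed_system R I \<longleftrightarrow>
     distinct (facilities I) \<and>
     sets_of R (family I) \<subseteq> Pow (facility_set I) \<and>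
     sets_of R (family I) \<noteq> {} \<and>
     (\<forall>S \<in> sets_of R (family I). \<forall>S' \<subseteq> S. S' \<in> sets_of R (family I))"


section \<open>The robust supplier problem\<close>

record 'r supplier = "'r set_system" +
  clients :: "nat list"
  distance :: "nat \<Rightarrow> nat \<Rightarrow> rat option"
  demand :: nat

abbreviation client_set :: "('r, 'b) supplier_scheme \<Rightarrow> nat set" where
  "client_set I \<equiv> set (clients I)"

definition pt_dist :: "'r supplier \<Rightarrow> nat \<Rightarrow> nat \<Rightarrow> ennreal" where
  "pt_dist I u v = (case distance I u v of None \<Rightarrow> \<infinity> | Some q \<Rightarrow> ennreal (real_of_rat q))"

definition metric_on :: "nat set \<Rightarrow> (nat \<Rightarrow> nat \<Rightarrow> ennreal) \<Rightarrow> bool" where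
  "metric_on X d \<longleftrightarrow>
     (\<forall>u \<in> X. \<forall>v \<in> X. d u v = 0 \<longleftrightarrow> u = v) \<and>
     (\<forall>u \<in> X. \<forall>v \<in> X. d u v = d v u) \<and>
     (\<forall>u \<in> X. \<forall>v \<in> X. \<forall>w \<in> X. d u w \<le> d u v + d v w)"

definition supplier_instance :: "'r representation \<Rightarrow> 'r supplier \<Rightarrow> bool" where
  "supplier_instance R I \<longleftrightarrow>
     down_closed_system R I \<and>
     distinct (clients I) \<and>
     (\<forall>u \<in> facility_set I \<union> client_set I. \<forall>v \<in> facility_set I \<union> client_set I. \<forall>q.
        distance I u v = Some q \<longrightarrow> q \<ge> 0) \<and>
     metric_on (facility_set I \<union> client_set I) (pt_dist I) \<and>
     demand I \<le> card (client_set I)"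

definition enc_supplier :: "'r representation \<Rightarrow> 'r supplier \<Rightarrow> tree" where
  "enc_supplier R I =
     (let xs = facilities I @ clients I in
      Node (enc_list enc_nat (facilities I))
     (Node (enc_list enc_nat (clients I))
     (Node (enc_list (\<lambda>u. enc_list (\<lambda>v. enc_dist (distance I u v)) xs) xs)
     (Node (enc_nat (demand I))
           (description R (family I))))))"

definition supplier_feasible :: "'r representation \<Rightarrow> 'r supplier \<Rightarrow> nat set \<Rightarrow> nat set \<Rightarrow> bool" where
  "supplier_feasible R I S T \<longleftrightarrow>
     S \<in> sets_of R (family I) \<and> T \<subseteq> client_set I \<and> card T \<ge> demand I"

text \<open>
  In \<^typ>\<open>ennreal\<close> the distance to the empty set is \<open>\<infinity>\<close> and the cost of an empty client set is 0.
\<close>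

definition dist_to_set :: "'r supplier \<Rightarrow> nat \<Rightarrow> nat set \<Rightarrow> ennreal" where
  "dist_to_set I v S = (INF u\<in>S. pt_dist I v u)"

definition supplier_cost :: "'r supplier \<Rightarrow> nat set \<Rightarrow> nat set \<Rightarrow> ennreal" where
  "supplier_cost I S T = (SUP u\<in>T. dist_to_set I u S)"

definition supplier_opt :: "'r representation \<Rightarrow> 'r supplier \<Rightarrow> ennreal" where
  "supplier_opt R I = (INF (S, T) \<in> {(S, T). supplier_feasible R I S T}. supplier_cost I S T)"

definition nontrivial_approximation :: "'r representation \<Rightarrow> prog \<Rightarrow> bool" where
  "nontrivial_approximation R B \<longleftrightarrow>
     (\<exists>\<alpha>::real. \<alpha> \<ge> 1 \<and>
       (\<forall>I. supplier_instance R I \<longrightarrow>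
         (\<exists>y z t S T.
            runs (reply R (family I)) B (enc_supplier R I) (Node y z) t \<and>
            encodes_set y S \<and> encodes_set z T \<and>
            supplier_feasible R I S T \<and>
            supplier_cost I S T \<le> ennreal \<alpha> * supplier_opt R I)))"

definition supplier_size :: "'r representation \<Rightarrow> 'r supplier \<Rightarrow> nat" where
  "supplier_size R I = size (enc_supplier R I)"

definition supplier_runs_in_time :: "'r representation \<Rightarrow> prog \<Rightarrow> (nat \<Rightarrow> nat) \<Rightarrow> bool" where
  "supplier_runs_in_time R B T \<longleftrightarrow>
     (\<forall>I. supplier_instance R I \<longrightarrow>
       (\<exists>y t. runs (reply R (family I)) B (enc_supplier R I) y t \<and> t \<le> T (supplier_size R I)))"


section \<open>The partition constrained maximization problem\<close>

record 'r pcm = "'r set_system" +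
  parts :: "nat list list"
  val :: "nat \<Rightarrow> nat"

text \<open>
  Distinctness of \<open>concat (parts J)\<close> says that the parts are pairwise disjoint and that each of them
  is listed without repetitions. The polynomial \<open>b\<close> is the bound on the values.
\<close>

definition pcm_instance :: "'r representation \<Rightarrow> nat poly \<Rightarrow> 'r pcm \<Rightarrow> bool" where
  "pcm_instance R b J \<longleftrightarrow>
     down_closed_system R J \<and>
     distinct (concat (parts J)) \<and>
     (\<forall>A \<in> set (parts J). set A \<subseteq> facility_set J) \<and>
     (\<forall>A \<in> set (parts J). \<forall>f \<in> set A. \<forall>g \<in> set A. val J f = val J g) \<and>
     (\<forall>f \<in> facility_set J. val J f \<le> poly b (card (facility_set J)))"

definition enc_pcm :: "'r representation \<Rightarrow> 'r pcm \<Rightarrow> tree" where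
  "enc_pcm R J =
      Node (enc_list enc_nat (facilities J))
     (Node (enc_list (enc_list enc_nat) (parts J))
     (Node (enc_list (\<lambda>f. enc_nat (val J f)) (facilities J))
           (description R (family J))))"

definition pcm_size :: "'r representation \<Rightarrow> 'r pcm \<Rightarrow> nat" where
  "pcm_size R J = size (enc_pcm R J)"

definition pcm_feasible :: "'r representation \<Rightarrow> 'r pcm \<Rightarrow> nat set \<Rightarrow> bool" where
  "pcm_feasible R J S \<longleftrightarrow>
     S \<in> sets_of R (family J) \<and> (\<forall>A \<in> set (parts J). card (S \<inter> set A) \<le> 1)"

definition pcm_optimal :: "'r representation \<Rightarrow> 'r pcm \<Rightarrow> nat set \<Rightarrow> bool" where
  "pcm_optimal R J S \<longleftrightarrow>
     pcm_feasible R J S \<and>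
     (\<forall>S'. pcm_feasible R J S' \<longrightarrow> (\<Sum>f\<in>S'. val J f) \<le> (\<Sum>f\<in>S. val J f))"

definition solves_pcm_within :: "'r representation \<Rightarrow> prog \<Rightarrow> 'r pcm \<Rightarrow> nat \<Rightarrow> bool" where
  "solves_pcm_within R A J n \<longleftrightarrow>
     (\<exists>y t S. runs (reply R (family J)) A (enc_pcm R J) y t \<and> t \<le> n \<and>
        encodes_set y S \<and> pcm_optimal R J S)"

end

theory Submission imports Defs begin

text \<open>
  Every part, and every facility outside all parts, forms a group. The supplier instance has one
  client per unit of the value of each group; points of one group are at distance 1 and points of
  different groups at distance infinity. A family member whose groups have total value at least
  \<open>m\<close> then gives a solution of cost at most 1 for demand \<open>m\<close>, and any solution of finite cost
  serves only clients whose group it hits. Hence an approximation with a finite factor either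
  answers demand \<open>m\<close> with a set whose groups have total value at least \<open>m\<close>, or shows that no member
  of the family has one. Trying all demands and keeping one facility per group of the last
  successful answer solves the maximization problem. All these calls are charged to the instance
  whose time bound is largest.
\<close>

section \<open>Polynomial-time functions\<close>

text \<open>Nothing but validity is known of the time bound of \<open>B\<close>; it need not be
  monotone. Calls for different demands can therefore not be compared beforehand, and the total time
  has to stay linear in the largest of their bounds, which is why the weight is tracked apart from
  the polynomials. Values come in binary while clients are written out one by one; the polynomial
  bound on values is what makes this expansion affordable. A call can only be judged by its answer,
  since the optimum is unknown to the algorithm. The judgement compares groups instead of distances:
  cost 1 times any finite factor stays below infinity, so a demand that can be met at all must be
  answered without crossing groups. The answer may contain several facilities of one group. The
  clients of a group represent its value only once, so dropping the surplus facilities loses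
  nothing. No program is written out as a whole: each closure rule yields the existence of one, and
  \<open>B\<close> enters as one more program whose runs are given.\<close>

text \<open>
  Correctness and running time are tracked together for families of computations indexed by \<open>i \<in> D\<close>:
  one program, independent of \<open>i\<close>, has to turn \<open>e i\<close> into \<open>f i\<close>. The \<open>weight\<close> is the price of a
  call of a foreign program (here the approximation algorithm); it enters linearly, so that loops
  still multiply the bounds by polynomials only. Under a loop the index is extended by the loop
  counter or the current list element, and the input \<open>e'\<close> of the body is left abstract: the body can
  only use what its hypotheses say is computable from \<open>e'\<close>.
\<close>

record resources =
  answer :: "tree \<Rightarrow> bool"
  input_size :: nat
  weight :: nat

definition poly_bounded :: "'i set \<Rightarrow> ('i \<Rightarrow> resources) \<Rightarrow> ('i \<Rightarrow> nat) \<Rightarrow> bool" where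
  "poly_bounded D \<kappa> f \<longleftrightarrow> (\<exists>P. \<forall>i\<in>D. f i \<le> poly P (input_size (\<kappa> i)))"

text \<open>\<open>Suc\<close> keeps the factor positive, so that polynomially many ordinary steps
  qualify even at weight 0.\<close>

definition time_bounded :: "'i set \<Rightarrow> ('i \<Rightarrow> resources) \<Rightarrow> ('i \<Rightarrow> nat) \<Rightarrow> bool" where
  "time_bounded D \<kappa> t \<longleftrightarrow>
    (\<exists>P. \<forall>i\<in>D. t i \<le> poly P (input_size (\<kappa> i)) * Suc (weight (\<kappa> i)))"

text \<open>Sizes are bounded apart from time and without the weight. Trees are shared, so
  repeatedly pairing a value with itself builds exponentially large trees in few steps, and a
  foreign call need not run in polynomial time; explicit size bounds are what allows composition and
  iteration.\<close>

definition polytime ::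
  "'i set \<Rightarrow> ('i \<Rightarrow> resources) \<Rightarrow> ('i \<Rightarrow> tree) \<Rightarrow> ('i \<Rightarrow> tree) \<Rightarrow> bool" where
  "polytime D \<kappa> e f \<longleftrightarrow>
    (\<exists>p t. (\<forall>i\<in>D. runs (answer (\<kappa> i)) p (e i) (f i) (t i)) \<and> time_bounded D \<kappa> t) \<and>
    poly_bounded D \<kappa> (\<lambda>i. size (e i)) \<and> poly_bounded D \<kappa> (\<lambda>i. size (f i))"

subsection \<open>Polynomial bounds\<close>

lemma poly_bounded_const: "poly_bounded D \<kappa> (\<lambda>_. c)"
  unfolding poly_bounded_def by (rule exI[of _ "[:c:]"]) simp

lemma poly_bounded_size: "poly_bounded D \<kappa> (\<lambda>i. input_size (\<kappa> i))"
  unfolding poly_bounded_def by (rule exI[of _ "[:0, 1:]"]) simp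

lemma poly_bounded_add:
  assumes "poly_bounded D \<kappa> f" and "poly_bounded D \<kappa> g"
  shows "poly_bounded D \<kappa> (\<lambda>i. f i + g i)"
proof -
  from assms obtain P Q where "\<forall>i\<in>D. f i \<le> poly P (input_size (\<kappa> i))"
    and "\<forall>i\<in>D. g i \<le> poly Q (input_size (\<kappa> i))"
    unfolding poly_bounded_def by blast
  then show ?thesis
    unfolding poly_bounded_def by (intro exI[of _ "P + Q"]) (simp add: add_mono)
qed

lemma poly_bounded_mult:
  assumes "poly_bounded D \<kappa> f" and "poly_bounded D \<kappa> g"
  shows "poly_bounded D \<kappa> (\<lambda>i. f i * g i)"
proof -
  from assms obtain P Q where "\<forall>i\<in>D. f i \<le> poly P (input_size (\<kappa> i))"
    and "\<forall>i\<in>D. g i \<le> poly Q (input_size (\<kappa> i))"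
    unfolding poly_bounded_def by blast
  then show ?thesis
    unfolding poly_bounded_def by (intro exI[of _ "P * Q"]) (simp add: mult_mono)
qed

lemma poly_bounded_mono:
  assumes "poly_bounded D \<kappa> f" and "\<And>i. i \<in> D \<Longrightarrow> g i \<le> f i"
  shows "poly_bounded D \<kappa> g"
  using assms unfolding poly_bounded_def by (meson order_trans)

lemma poly_bounded_reindex:
  assumes "poly_bounded D \<kappa> f" and "\<And>j. j \<in> D' \<Longrightarrow> h j \<in> D"
  shows "poly_bounded D' (\<lambda>j. \<kappa> (h j)) (\<lambda>j. f (h j))"
  using assms unfolding poly_bounded_def by blast

lemma poly_bounded_if:
  assumes "poly_bounded {i \<in> D. c i} \<kappa> f" and "poly_bounded {i \<in> D. \<not> c i} \<kappa> g"
  shows "poly_bounded D \<kappa> (\<lambda>i. if c i then f i else g i)"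
proof -
  from assms obtain P Q where "\<forall>i\<in>{i \<in> D. c i}. f i \<le> poly P (input_size (\<kappa> i))"
    and "\<forall>i\<in>{i \<in> D. \<not> c i}. g i \<le> poly Q (input_size (\<kappa> i))"
    unfolding poly_bounded_def by blast
  then show ?thesis
    unfolding poly_bounded_def by (intro exI[of _ "P + Q"]) (auto simp: trans_le_add1 trans_le_add2)
qed

text \<open>Meant for \<open>D'\<close> indexing the rounds of a loop with outer index
  \<open>h j\<close>. All rounds share the resources of the outer index, so the polynomial evaluated
  there bounds every round at once.\<close>

lemma poly_bounded_uniform:
  assumes "poly_bounded D' (\<lambda>j. \<kappa> (h j)) f"
  obtains u where "poly_bounded D \<kappa> u" and "\<And>j. j \<in> D' \<Longrightarrow> f j \<le> u (h j)"
proof -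
  from assms obtain P where "\<forall>j\<in>D'. f j \<le> poly P (input_size (\<kappa> (h j)))"
    unfolding poly_bounded_def by blast
  then show ?thesis
    by (intro that[of "\<lambda>i. poly P (input_size (\<kappa> i))"]) (auto simp: poly_bounded_def)
qed

lemma poly_nat_mono: "(m::nat) \<le> n \<Longrightarrow> poly P m \<le> poly P n"
  by (induction P) (auto intro: add_mono mult_mono)

lemma poly_bounded_poly:
  assumes "poly_bounded D \<kappa> f"
  shows "poly_bounded D \<kappa> (\<lambda>i. poly P (f i))"
proof -
  from assms obtain Q where "\<forall>i\<in>D. f i \<le> poly Q (input_size (\<kappa> i))"
    unfolding poly_bounded_def by blast
  then show ?thesis
    unfolding poly_bounded_def by (intro exI[of _ "pcompose P Q"]) (simp add: poly_pcompose poly_nat_mono)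
qed

section \<open>Time bounds linear in the weight\<close>

lemma time_bounded_const: "time_bounded D \<kappa> (\<lambda>_. c)"
  unfolding time_bounded_def by (rule exI[of _ "[:c:]"]) simp

lemma time_bounded_add:
  assumes "time_bounded D \<kappa> f" and "time_bounded D \<kappa> g"
  shows "time_bounded D \<kappa> (\<lambda>i. f i + g i)"
proof -
  from assms obtain P Q where "\<forall>i\<in>D. f i \<le> poly P (input_size (\<kappa> i)) * Suc (weight (\<kappa> i))"
    and "\<forall>i\<in>D. g i \<le> poly Q (input_size (\<kappa> i)) * Suc (weight (\<kappa> i))"
    unfolding time_bounded_def by blast
  then show ?thesis
    unfolding time_bounded_def
    by (intro exI[of _ "P + Q"]) (metis add_mono distrib_right poly_add)
qed

text \<open>The asymmetry keeps loops linear in the weight: the number of rounds is bounded without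
  it, and only the time per round may contain it.\<close>

lemma time_bounded_mult:
  assumes "poly_bounded D \<kappa> f" and "time_bounded D \<kappa> g"
  shows "time_bounded D \<kappa> (\<lambda>i. f i * g i)"
proof -
  from assms obtain P Q where "\<forall>i\<in>D. f i \<le> poly P (input_size (\<kappa> i))"
    and "\<forall>i\<in>D. g i \<le> poly Q (input_size (\<kappa> i)) * Suc (weight (\<kappa> i))"
    unfolding time_bounded_def poly_bounded_def by blast
  then show ?thesis
    unfolding time_bounded_def
    by (intro exI[of _ "P * Q"]) (unfold poly_mult mult.assoc, blast intro: mult_le_mono)
qed

lemma time_bounded_reindex:
  assumes "time_bounded D \<kappa> f" and "\<And>j. j \<in> D' \<Longrightarrow> h j \<in> D"
  shows "time_bounded D' (\<lambda>j. \<kappa> (h j)) (\<lambda>j. f (h j))"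
  using assms unfolding time_bounded_def by blast

lemma time_bounded_mono:
  assumes "time_bounded D \<kappa> f" and "\<And>i. i \<in> D \<Longrightarrow> g i \<le> f i"
  shows "time_bounded D \<kappa> g"
  using assms unfolding time_bounded_def by (meson order_trans)

lemma time_bounded_if:
  assumes "time_bounded {i \<in> D. c i} \<kappa> f" and "time_bounded {i \<in> D. \<not> c i} \<kappa> g"
  shows "time_bounded D \<kappa> (\<lambda>i. if c i then f i else g i)"
proof -
  from assms obtain P Q
    where "\<forall>i\<in>{i \<in> D. c i}. f i \<le> poly P (input_size (\<kappa> i)) * Suc (weight (\<kappa> i))"
    and "\<forall>i\<in>{i \<in> D. \<not> c i}. g i \<le> poly Q (input_size (\<kappa> i)) * Suc (weight (\<kappa> i))"
    unfolding time_bounded_def by blast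
  then show ?thesis
    unfolding time_bounded_def
    by (intro exI[of _ "P + Q"]) (auto simp: distrib_right trans_le_add1 trans_le_add2 simp del: mult_Suc_right)
qed

lemma time_bounded_uniform:
  assumes "time_bounded D' (\<lambda>j. \<kappa> (h j)) f"
  obtains u where "time_bounded D \<kappa> u" and "\<And>j. j \<in> D' \<Longrightarrow> f j \<le> u (h j)"
proof -
  from assms obtain P where "\<forall>j\<in>D'. f j \<le> poly P (input_size (\<kappa> (h j))) * Suc (weight (\<kappa> (h j)))"
    unfolding time_bounded_def by blast
  then show ?thesis
    by (intro that[of "\<lambda>i. poly P (input_size (\<kappa> i)) * Suc (weight (\<kappa> i))"])
      (auto simp: time_bounded_def)
qed

subsection \<open>Closure properties of polynomial-time functions\<close>

lemma polytimeI:
  assumes "\<And>i. i \<in> D \<Longrightarrow> runs (answer (\<kappa> i)) p (e i) (f i) (t i)" and "time_bounded D \<kappa> t"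
    and "poly_bounded D \<kappa> (\<lambda>i. size (e i))" and "poly_bounded D \<kappa> (\<lambda>i. size (f i))"
  shows "polytime D \<kappa> e f"
  using assms unfolding polytime_def by blast

lemma polytime_input: "polytime D \<kappa> e f \<Longrightarrow> poly_bounded D \<kappa> (\<lambda>i. size (e i))"
  and polytime_output: "polytime D \<kappa> e f \<Longrightarrow> poly_bounded D \<kappa> (\<lambda>i. size (f i))"
  by (simp_all add: polytime_def)

lemma polytime_id:
  assumes "poly_bounded D \<kappa> (\<lambda>i. size (e i))"
  shows "polytime D \<kappa> e e"
  using assms by (intro polytimeI[where t = "\<lambda>_. 1" and p = Ident] runs.Ident time_bounded_const)

lemma polytime_cong:
  assumes "polytime D \<kappa> e f" and "\<And>i. i \<in> D \<Longrightarrow> f i = g i"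
  shows "polytime D \<kappa> e g"
  using assms unfolding polytime_def poly_bounded_def by auto

lemma polytime_reindex:
  assumes "polytime D \<kappa> e f" and "\<And>j. j \<in> D' \<Longrightarrow> h j \<in> D"
  shows "polytime D' (\<lambda>j. \<kappa> (h j)) (\<lambda>j. e (h j)) (\<lambda>j. f (h j))"
proof -
  from assms(1) obtain p t where "\<And>i. i \<in> D \<Longrightarrow> runs (answer (\<kappa> i)) p (e i) (f i) (t i)"
    and "time_bounded D \<kappa> t" unfolding polytime_def by blast
  then show ?thesis
    using assms(2) by (intro polytimeI[OF _ time_bounded_reindex[where f = t and D = D]
        poly_bounded_reindex[OF polytime_input[OF assms(1)]]
        poly_bounded_reindex[OF polytime_output[OF assms(1)]], where p = p]) blast+
qed

lemma polytime_subset: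
  assumes "polytime D \<kappa> e f" and "D' \<subseteq> D"
  shows "polytime D' \<kappa> e f"
  using polytime_reindex[OF assms(1), of D' "\<lambda>j. j"] assms(2) by auto

lemma polytime_comp:
  assumes "polytime D \<kappa> e f" and "polytime D \<kappa> f g"
  shows "polytime D \<kappa> e g"
proof -
  from assms(1) obtain p s where 1: "\<And>i. i \<in> D \<Longrightarrow> runs (answer (\<kappa> i)) p (e i) (f i) (s i)"
    "time_bounded D \<kappa> s" unfolding polytime_def by blast
  from assms(2) obtain q t where 2: "\<And>i. i \<in> D \<Longrightarrow> runs (answer (\<kappa> i)) q (f i) (g i) (t i)"
    "time_bounded D \<kappa> t" unfolding polytime_def by blast
  have "runs (answer (\<kappa> i)) (Seq p q) (e i) (g i) (s i + t i + 1)" if "i \<in> D" for i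
    by (rule runs.Seq[OF 1(1)[OF that] 2(1)[OF that]])
  then show ?thesis
    by (intro polytimeI[where t = "\<lambda>i. s i + t i + 1" and p = "Seq p q"]
        time_bounded_add time_bounded_const polytime_input[OF assms(1)] polytime_output[OF assms(2)] 1 2)
qed

lemma polytime_left:
  assumes "polytime D \<kappa> e f"
  shows "polytime D \<kappa> e (\<lambda>i. left (f i))"
proof (rule polytime_comp[OF assms])
  have "size (left x) \<le> size x" for x by (cases x) auto
  then show "polytime D \<kappa> f (\<lambda>i. left (f i))"
    by (intro polytimeI[where t = "\<lambda>_. 1" and p = Left] runs.Left time_bounded_const polytime_output[OF assms]
        poly_bounded_mono[OF polytime_output[OF assms]])
qed

lemma polytime_right:
  assumes "polytime D \<kappa> e f"
  shows "polytime D \<kappa> e (\<lambda>i. right (f i))"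
proof (rule polytime_comp[OF assms])
  have "size (right x) \<le> size x" for x by (cases x) auto
  then show "polytime D \<kappa> f (\<lambda>i. right (f i))"
    by (intro polytimeI[where t = "\<lambda>_. 1" and p = Right] runs.Right time_bounded_const polytime_output[OF assms]
        poly_bounded_mono[OF polytime_output[OF assms]])
qed

lemma polytime_fst: "polytime D \<kappa> e (\<lambda>i. Node (f i) (g i)) \<Longrightarrow> polytime D \<kappa> e f"
  and polytime_snd: "polytime D \<kappa> e (\<lambda>i. Node (f i) (g i)) \<Longrightarrow> polytime D \<kappa> e g"
  using polytime_left[of D \<kappa> e "\<lambda>i. Node (f i) (g i)"]
    polytime_right[of D \<kappa> e "\<lambda>i. Node (f i) (g i)"] by simp_all

lemma polytime_pair:
  assumes "polytime D \<kappa> e f" and "polytime D \<kappa> e g"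
  shows "polytime D \<kappa> e (\<lambda>i. Node (f i) (g i))"
proof -
  from assms(1) obtain p s where 1: "\<And>i. i \<in> D \<Longrightarrow> runs (answer (\<kappa> i)) p (e i) (f i) (s i)"
    "time_bounded D \<kappa> s" unfolding polytime_def by blast
  from assms(2) obtain q t where 2: "\<And>i. i \<in> D \<Longrightarrow> runs (answer (\<kappa> i)) q (e i) (g i) (t i)"
    "time_bounded D \<kappa> t" unfolding polytime_def by blast
  have "poly_bounded D \<kappa> (\<lambda>i. size (Node (f i) (g i)))"
    unfolding tree.size
    by (intro poly_bounded_add poly_bounded_const polytime_output[OF assms(1)] polytime_output[OF assms(2)])
  then show ?thesis
    by (intro polytimeI[where t = "\<lambda>i. s i + t i + 1" and p = "Pair p q"] runs.Pair
        time_bounded_add time_bounded_const polytime_input[OF assms(1)] 1 2)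
qed

lemma polytime_const:
  assumes "poly_bounded D \<kappa> (\<lambda>i. size (e i))"
  shows "polytime D \<kappa> e (\<lambda>_. x)"
proof (induction x)
  case Leaf
  show ?case
    by (intro polytimeI[where t = "\<lambda>_. 1" and p = Const_Leaf] runs.Const_Leaf time_bounded_const poly_bounded_const assms)
next
  case (Node x y)
  then show ?case by (rule polytime_pair)
qed

lemma polytime_if:
  assumes c: "polytime D \<kappa> e (\<lambda>i. enc_bool (c i))"
    and f: "polytime {i \<in> D. c i} \<kappa> e f" and g: "polytime {i \<in> D. \<not> c i} \<kappa> e g"
  shows "polytime D \<kappa> e (\<lambda>i. if c i then f i else g i)"
proof -
  from c obtain r u where 0: "\<And>i. i \<in> D \<Longrightarrow> runs (answer (\<kappa> i)) r (e i) (enc_bool (c i)) (u i)"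
    "time_bounded D \<kappa> u" unfolding polytime_def by blast
  from f obtain p s where 1: "\<And>i. i \<in> {i \<in> D. c i} \<Longrightarrow> runs (answer (\<kappa> i)) p (e i) (f i) (s i)"
    "time_bounded {i \<in> D. c i} \<kappa> s" unfolding polytime_def by blast
  from g obtain q t where 2: "\<And>i. i \<in> {i \<in> D. \<not> c i} \<Longrightarrow> runs (answer (\<kappa> i)) q (e i) (g i) (t i)"
    "time_bounded {i \<in> D. \<not> c i} \<kappa> t" unfolding polytime_def by blast
  have "poly_bounded D \<kappa> (\<lambda>i. if c i then size (f i) else size (g i))"
    by (rule poly_bounded_if) (use f g polytime_output in blast)+
  then have size: "poly_bounded D \<kappa> (\<lambda>i. size (if c i then f i else g i))"
    by (rule poly_bounded_mono) simp
  have "runs (answer (\<kappa> i)) (Cond r p q) (e i) (if c i then f i else g i)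
      (u i + (if c i then s i else t i) + 1)" if "i \<in> D" for i
    using 0(1)[OF that] 1(1)[of i] 2(1)[of i] that
    by (auto intro: runs.Cond_True[where b = "Node Leaf Leaf", simplified]
        runs.Cond_False[simplified] simp: enc_bool_def)
  then show ?thesis
    by (intro polytimeI[where t = "\<lambda>i. u i + (if c i then s i else t i) + 1" and p = "Cond r p q"]
        time_bounded_add time_bounded_if time_bounded_const 0 1 2 size polytime_input[OF c])
qed

text \<open>Conditions of the machine accept every tree other than \<open>Leaf\<close>; this
  normalises the outcome to \<open>enc_bool\<close>, the form in which truth values are combined
  later.\<close>

lemma polytime_nonleaf:
  assumes "polytime D \<kappa> e f"
  shows "polytime D \<kappa> e (\<lambda>i. enc_bool (f i \<noteq> Leaf))"
proof (rule polytime_comp[OF assms])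
  have "runs Q (Cond Ident (Pair Const_Leaf Const_Leaf) Const_Leaf) x (enc_bool (x \<noteq> Leaf))
      (if x \<noteq> Leaf then 1 + (1 + 1 + 1) + 1 else 1 + 1 + 1)" for Q x
    unfolding enc_bool_def by (cases "x = Leaf")
      (simp_all only: if_True if_False not_True_eq_False not_False_eq_True refl simp_thms,
       rule runs.Cond_False, rule runs.Ident, rule runs.Const_Leaf,
       rule runs.Cond_True, rule runs.Ident, simp, intro runs.intros)
  note run = this
  show "polytime D \<kappa> f (\<lambda>i. enc_bool (f i \<noteq> Leaf))"
  proof (rule polytimeI)
    show "runs (answer (\<kappa> i)) (Cond Ident (Pair Const_Leaf Const_Leaf) Const_Leaf) (f i)
        (enc_bool (f i \<noteq> Leaf)) (if f i \<noteq> Leaf then 1 + (1 + 1 + 1) + 1 else 1 + 1 + 1)" for i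
      by (rule run)
    show "time_bounded D \<kappa> (\<lambda>i. if f i \<noteq> Leaf then 1 + (1 + 1 + 1) + 1 else 1 + 1 + 1)"
      by (intro time_bounded_if time_bounded_const)
    show "poly_bounded D \<kappa> (\<lambda>i. size (enc_bool (f i \<noteq> Leaf)))"
      by (rule poly_bounded_mono[OF poly_bounded_const[where c = 1]]) (simp add: enc_bool_def)
  qed (rule polytime_output[OF assms])
qed

lemma polytime_while:
  fixes n :: "'i \<Rightarrow> nat" and st :: "'i \<Rightarrow> nat \<Rightarrow> tree"
  assumes init: "polytime D \<kappa> e (\<lambda>i. st i 0)"
    and test: "polytime (Sigma D (\<lambda>i. {..n i})) (\<lambda>j. \<kappa> (fst j)) (\<lambda>j. st (fst j) (snd j))
      (\<lambda>j. enc_bool (snd j < n (fst j)))"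
    and body: "polytime (Sigma D (\<lambda>i. {..<n i})) (\<lambda>j. \<kappa> (fst j)) (\<lambda>j. st (fst j) (snd j))
      (\<lambda>j. st (fst j) (Suc (snd j)))"
    and n: "poly_bounded D \<kappa> n"
  shows "polytime D \<kappa> e (\<lambda>i. st i (n i))"
proof (rule polytime_comp[OF init])
  from test obtain c s where 1: "\<And>j. j \<in> Sigma D (\<lambda>i. {..n i}) \<Longrightarrow>
      runs (answer (\<kappa> (fst j))) c (st (fst j) (snd j)) (enc_bool (snd j < n (fst j))) (s j)"
    and "time_bounded (Sigma D (\<lambda>i. {..n i})) (\<lambda>j. \<kappa> (fst j)) s"
    unfolding polytime_def by blast
  then obtain s' where s': "time_bounded D \<kappa> s'"
    "\<And>j. j \<in> Sigma D (\<lambda>i. {..n i}) \<Longrightarrow> s j \<le> s' (fst j)"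
    using time_bounded_uniform[of _ \<kappa> fst s D] by metis
  from body obtain p t where 2: "\<And>j. j \<in> Sigma D (\<lambda>i. {..<n i}) \<Longrightarrow>
      runs (answer (\<kappa> (fst j))) p (st (fst j) (snd j)) (st (fst j) (Suc (snd j))) (t j)"
    and "time_bounded (Sigma D (\<lambda>i. {..<n i})) (\<lambda>j. \<kappa> (fst j)) t"
    unfolding polytime_def by blast
  then obtain t' where t': "time_bounded D \<kappa> t'"
    "\<And>j. j \<in> Sigma D (\<lambda>i. {..<n i}) \<Longrightarrow> t j \<le> t' (fst j)"
    using time_bounded_uniform[of _ \<kappa> fst t D] by metis
  \<comment> \<open>\<open>k\<close> counts the rounds still to be done: the run is assembled from
    its end, because \<open>While_True\<close> takes the run of the remaining loop as a premise. The
    factor \<open>k + 1\<close> also pays for the last, failing test.\<close>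
  have "\<exists>u. runs (answer (\<kappa> i)) (While c p) (st i (n i - k)) (st i (n i)) u \<and>
      u \<le> (k + 1) * (s' i + t' i + 1)" if "i \<in> D" "k \<le> n i" for i k
    using that(2)
  proof (induction k)
    case 0
    have "runs (answer (\<kappa> i)) c (st i (n i)) Leaf (s (i, n i))"
      using 1[of "(i, n i)"] that(1) by (simp add: enc_bool_def)
    from runs.While_False[OF this, of p] show ?case
      using s'(2)[of "(i, n i)"] that(1) by force
  next
    case (Suc k)
    let ?m = "n i - Suc k"
    from Suc have m: "?m < n i" "Suc ?m = n i - k" by auto
    from Suc obtain u where u: "runs (answer (\<kappa> i)) (While c p) (st i (Suc ?m)) (st i (n i)) u"
      "u \<le> (k + 1) * (s' i + t' i + 1)" using m by auto
    have c: "runs (answer (\<kappa> i)) c (st i ?m) (enc_bool True) (s (i, ?m))"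
      using 1[of "(i, ?m)"] that(1) m by simp
    have p: "runs (answer (\<kappa> i)) p (st i ?m) (st i (Suc ?m)) (t (i, ?m))"
      using 2[of "(i, ?m)"] that(1) m by simp
    have "runs (answer (\<kappa> i)) (While c p) (st i ?m) (st i (n i)) (s (i, ?m) + t (i, ?m) + u + 1)"
      by (rule runs.While_True[OF c _ p u(1)]) (simp add: enc_bool_def)
    moreover have "s (i, ?m) + t (i, ?m) + u + 1 \<le> (Suc k + 1) * (s' i + t' i + 1)"
      using s'(2)[of "(i, ?m)"] t'(2)[of "(i, ?m)"] u(2) that(1) m by simp
    ultimately show ?case by blast
  qed
  then have "\<exists>u. runs (answer (\<kappa> i)) (While c p) (st i 0) (st i (n i)) u \<and>
      u \<le> (n i + 1) * (s' i + t' i + 1)" if "i \<in> D" for i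
    using that by (metis order_refl diff_self_eq_0)
  then obtain u where u: "\<And>i. i \<in> D \<Longrightarrow> runs (answer (\<kappa> i)) (While c p) (st i 0) (st i (n i)) (u i)"
    and le: "\<And>i. i \<in> D \<Longrightarrow> u i \<le> (n i + 1) * (s' i + t' i + 1)"
    by metis
  have time: "time_bounded D \<kappa> (\<lambda>i. (n i + 1) * (s' i + t' i + 1))"
    by (intro time_bounded_mult time_bounded_add poly_bounded_add n poly_bounded_const time_bounded_const s' t')
  have size: "poly_bounded D \<kappa> (\<lambda>i. size (st i (n i)))"
    using poly_bounded_reindex[OF polytime_input[OF test], of D "\<lambda>i. (i, n i)"] by simp
  show "polytime D \<kappa> (\<lambda>i. st i 0) (\<lambda>i. st i (n i))"
    by (rule polytimeI[OF u time_bounded_mono[OF time le] polytime_output[OF init] size])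
qed

subsection \<open>Lists\<close>

lemma enc_list_Nil [simp]: "enc_list e [] = Leaf"
  and enc_list_Cons [simp]: "enc_list e (x # xs) = Node (e x) (enc_list e xs)"
  by (simp_all add: enc_list_def)

lemma size_enc_list: "size (enc_list e xs) = (\<Sum>x\<leftarrow>xs. Suc (size (e x)))"
  by (induction xs) simp_all

lemma size_enc_list_append [simp]:
  "size (enc_list e (xs @ ys)) = size (enc_list e xs) + size (enc_list e ys)"
  by (simp add: size_enc_list)

lemma enc_list_eq_Leaf_iff [simp]: "enc_list e xs = Leaf \<longleftrightarrow> xs = []"
  by (cases xs) simp_all

lemma right_enc_list: "right (enc_list e xs) = enc_list e (tl xs)"
  by (cases xs) simp_all

lemma left_enc_list: "xs \<noteq> [] \<Longrightarrow> left (enc_list e xs) = e (hd xs)"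
  by (cases xs) simp_all

lemma length_le_size_enc_list: "length xs \<le> size (enc_list e xs)"
  by (induction xs) auto

lemma size_elem_le_size_enc_list: "x \<in> set xs \<Longrightarrow> size (e x) \<le> size (enc_list e xs)"
  by (induction xs) auto

lemma size_enc_list_take: "size (enc_list e (take k xs)) \<le> size (enc_list e xs)"
  by (metis append_take_drop_id size_enc_list_append le_add1)

lemma size_enc_list_drop: "size (enc_list e (drop k xs)) \<le> size (enc_list e xs)"
  by (metis append_take_drop_id size_enc_list_append le_add2)

lemma size_enc_list_rev [simp]: "size (enc_list e (rev xs)) = size (enc_list e xs)"
  by (simp add: size_enc_list rev_map[symmetric])

lemma size_enc_list_bound:
  "(\<And>x. x \<in> set xs \<Longrightarrow> size (e x) \<le> b) \<Longrightarrow> size (enc_list e xs) \<le> length xs * Suc b"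
proof (induction xs)
  case (Cons x xs)
  then have "size (e x) \<le> b" and "size (enc_list e xs) \<le> length xs * Suc b" by auto
  then show ?case by simp
qed simp

lemma enc_list_map: "enc_list e (map f xs) = enc_list (\<lambda>x. e (f x)) xs"
  by (induction xs) auto

lemma size_enc_bool: "size (enc_bool b) \<le> 1"
  by (simp add: enc_bool_def)

lemma polytime_length:
  assumes "polytime D \<kappa> e (\<lambda>i. enc_list ex (xs i))"
  shows "poly_bounded D \<kappa> (\<lambda>i. length (xs i))"
  by (rule poly_bounded_mono[OF polytime_output[OF assms] length_le_size_enc_list])

lemma polytime_const':
  assumes "polytime D \<kappa> e f"
  shows "polytime D \<kappa> e (\<lambda>_. x)"
  by (rule polytime_const[OF polytime_input[OF assms]])

lemma polytime_Nil:
  assumes "polytime D \<kappa> e f"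
  shows "polytime D \<kappa> e (\<lambda>i. enc_list ex [])"
  using polytime_const'[OF assms] by simp

text \<open>The bound on all intermediate accumulators is a hypothesis of its own because growth
  that is polynomial in each single round can compound over the rounds.\<close>

lemma polytime_iterate:
  fixes s :: "'i \<Rightarrow> nat \<Rightarrow> tree" and xs :: "'i \<Rightarrow> 'x list" and D :: "'i set"
  defines "D' \<equiv> Sigma D (\<lambda>i. {..<length (xs i)})"
  assumes xs: "polytime D \<kappa> e (\<lambda>i. enc_list ex (xs i))"
    and init: "polytime D \<kappa> e (\<lambda>i. s i 0)"
    and bound: "poly_bounded (Sigma D (\<lambda>i. {..length (xs i)})) (\<lambda>j. \<kappa> (fst j))
      (\<lambda>j. size (s (fst j) (snd j)))"
    and step: "\<And>e'. polytime (D') (\<lambda>j. \<kappa> (fst j)) e' (\<lambda>j. ex (xs (fst j) ! snd j)) \<Longrightarrow>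
      polytime (D') (\<lambda>j. \<kappa> (fst j)) e' (\<lambda>j. s (fst j) (snd j)) \<Longrightarrow>
      (\<And>g. polytime D \<kappa> e g \<Longrightarrow> polytime (D') (\<lambda>j. \<kappa> (fst j)) e' (\<lambda>j. g (fst j))) \<Longrightarrow>
      polytime (D') (\<lambda>j. \<kappa> (fst j)) e' (\<lambda>j. s (fst j) (Suc (snd j)))"
  shows "polytime D \<kappa> e (\<lambda>i. s i (length (xs i)))"
proof -
  \<comment> \<open>Besides the unread suffix and the accumulator the state keeps the original
    input, from which the body can recompute whatever \<open>e\<close> yields; this supplies the
    last hypothesis of \<open>step\<close>.\<close>
  define st where "st i k = Node (enc_list ex (drop k (xs i))) (Node (s i k) (e i))" for i k
  let ?\<kappa> = "\<lambda>j. \<kappa> (fst j)"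
  have e: "polytime D \<kappa> e e"
    by (rule polytime_id[OF polytime_input[OF xs]])
  have st: "polytime (Sigma D (\<lambda>i. {..length (xs i)})) ?\<kappa> (\<lambda>j. st (fst j) (snd j)) (\<lambda>j. st (fst j) (snd j))"
  proof (rule polytime_id, rule poly_bounded_mono)
    show "poly_bounded (Sigma D (\<lambda>i. {..length (xs i)})) ?\<kappa>
       (\<lambda>j. (size (enc_list ex (xs (fst j))) + (size (s (fst j) (snd j)) + size (e (fst j)) + 1)) + 1)"
      by (intro poly_bounded_add poly_bounded_const bound
          poly_bounded_reindex[OF polytime_output[OF xs]] poly_bounded_reindex[OF polytime_input[OF xs]]) auto
  qed (simp add: st_def size_enc_list_drop)
  then have st': "polytime (D') ?\<kappa> (\<lambda>j. st (fst j) (snd j)) (\<lambda>j. st (fst j) (snd j))"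
    by (rule polytime_subset) (auto simp: D'_def)
  have "polytime D \<kappa> e (\<lambda>i. st i (length (xs i)))"
  proof (rule polytime_while)
    show "polytime D \<kappa> e (\<lambda>i. st i 0)"
      unfolding st_def drop_0 by (intro polytime_pair xs init e)
    show "polytime (Sigma D (\<lambda>i. {..length (xs i)})) ?\<kappa> (\<lambda>j. st (fst j) (snd j))
        (\<lambda>j. enc_bool (snd j < length (xs (fst j))))"
      by (rule polytime_cong[OF polytime_nonleaf[OF polytime_left[OF st]]])
        (auto simp: st_def intro!: arg_cong[where f = enc_bool])
    show "poly_bounded D \<kappa> (\<lambda>i. length (xs i))"
      by (rule polytime_length[OF xs])
    have x: "polytime (D') ?\<kappa> (\<lambda>j. st (fst j) (snd j)) (\<lambda>j. ex (xs (fst j) ! snd j))"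
      by (rule polytime_cong[OF polytime_left[OF polytime_left[OF st']]])
        (auto simp: st_def D'_def left_enc_list hd_drop_conv_nth)
    have s: "polytime (D') ?\<kappa> (\<lambda>j. st (fst j) (snd j)) (\<lambda>j. s (fst j) (snd j))"
      by (rule polytime_cong[OF polytime_left[OF polytime_right[OF st']]]) (auto simp: st_def)
    have e': "polytime (D') ?\<kappa> (\<lambda>j. st (fst j) (snd j)) (\<lambda>j. e (fst j))"
      by (rule polytime_cong[OF polytime_right[OF polytime_right[OF st']]]) (auto simp: st_def)
    have "polytime (D') ?\<kappa> (\<lambda>j. st (fst j) (snd j)) (\<lambda>j. s (fst j) (Suc (snd j)))"
      by (rule step[OF x s], rule polytime_comp[OF e'], rule polytime_reindex) (auto simp: D'_def)
    moreover have "polytime (D') ?\<kappa> (\<lambda>j. st (fst j) (snd j))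
        (\<lambda>j. enc_list ex (drop (Suc (snd j)) (xs (fst j))))"
      by (rule polytime_cong[OF polytime_right[OF polytime_left[OF st']]])
        (auto simp: st_def right_enc_list drop_Suc tl_drop)
    ultimately show "polytime (Sigma D (\<lambda>i. {..<length (xs i)})) ?\<kappa> (\<lambda>j. st (fst j) (snd j))
        (\<lambda>j. st (fst j) (Suc (snd j)))"
      unfolding st_def[of _ "Suc _"] D'_def[symmetric] by (intro polytime_pair e')
  qed
  then have "polytime D \<kappa> e (\<lambda>i. left (right (st i (length (xs i)))))"
    by (intro polytime_left polytime_right)
  then show ?thesis
    by (simp add: st_def)
qed

text \<open>A list grows only at its front, so a single pass delivers its result reversed. Reversal
  and concatenation are both obtained from this pass.\<close>

lemma polytime_rev_append:
  assumes xs: "polytime D \<kappa> e (\<lambda>i. enc_list ex (xs i))" and ys: "polytime D \<kappa> e (\<lambda>i. enc_list ex (ys i))"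
  shows "polytime D \<kappa> e (\<lambda>i. enc_list ex (rev (xs i) @ ys i))"
proof -
  define s where "s i k = enc_list ex (rev (take k (xs i)) @ ys i)" for i k
  have "polytime D \<kappa> e (\<lambda>i. s i (length (xs i)))"
  proof (rule polytime_iterate[OF xs])
    show "polytime D \<kappa> e (\<lambda>i. s i 0)"
      using ys by (simp add: s_def)
    have "poly_bounded (SIGMA i:D. {..length (xs i)}) (\<lambda>j. \<kappa> (fst j))
        (\<lambda>j. size (enc_list ex (xs (fst j))) + size (enc_list ex (ys (fst j))))"
      by (intro poly_bounded_add poly_bounded_reindex[OF polytime_output[OF xs]]
          poly_bounded_reindex[OF polytime_output[OF ys]]) auto
    then show "poly_bounded (SIGMA i:D. {..length (xs i)}) (\<lambda>j. \<kappa> (fst j)) (\<lambda>j. size (s (fst j) (snd j)))"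
      by (rule poly_bounded_mono) (simp add: s_def size_enc_list_take)
  next
    fix e'
    let ?D = "SIGMA i:D. {..<length (xs i)}"
    assume x: "polytime ?D (\<lambda>j. \<kappa> (fst j)) e' (\<lambda>j. ex (xs (fst j) ! snd j))"
      and s: "polytime ?D (\<lambda>j. \<kappa> (fst j)) e' (\<lambda>j. s (fst j) (snd j))"
    show "polytime ?D (\<lambda>j. \<kappa> (fst j)) e' (\<lambda>j. s (fst j) (Suc (snd j)))"
      by (rule polytime_cong[OF polytime_pair[OF x s]]) (auto simp: s_def take_Suc_conv_app_nth)
  qed
  then show ?thesis
    by (simp add: s_def)
qed

lemma polytime_rev:
  assumes "polytime D \<kappa> e (\<lambda>i. enc_list ex (xs i))"
  shows "polytime D \<kappa> e (\<lambda>i. enc_list ex (rev (xs i)))"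
  using polytime_rev_append[OF assms polytime_Nil[OF assms]] by simp

lemma polytime_append:
  assumes "polytime D \<kappa> e (\<lambda>i. enc_list ex (xs i))" and "polytime D \<kappa> e (\<lambda>i. enc_list ex (ys i))"
  shows "polytime D \<kappa> e (\<lambda>i. enc_list ex (xs i @ ys i))"
  using polytime_rev_append[OF polytime_rev[OF assms(1)] assms(2)] by simp

lemma polytime_map:
  fixes xs :: "'i \<Rightarrow> 'x list" and D :: "'i set"
  defines "D' \<equiv> Sigma D (\<lambda>i. set (xs i))"
  assumes xs: "polytime D \<kappa> e (\<lambda>i. enc_list ex (xs i))"
    and step: "\<And>e'. polytime (D') (\<lambda>j. \<kappa> (fst j)) e' (\<lambda>j. ex (snd j)) \<Longrightarrow>
      (\<And>g. polytime D \<kappa> e g \<Longrightarrow> polytime (D') (\<lambda>j. \<kappa> (fst j)) e' (\<lambda>j. g (fst j))) \<Longrightarrow>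
      polytime (D') (\<lambda>j. \<kappa> (fst j)) e' (\<lambda>j. ey (f (fst j) (snd j)))"
  shows "polytime D \<kappa> e (\<lambda>i. enc_list ey (map (f i) (xs i)))"
proof -
  let ?\<kappa> = "\<lambda>j. \<kappa> (fst j)"
  have e: "polytime D \<kappa> e e"
    by (rule polytime_id[OF polytime_input[OF xs]])
  define e' where "e' j = Node (ex (snd j)) (e (fst j))" for j
  have "poly_bounded (D') ?\<kappa> (\<lambda>j. size (enc_list ex (xs (fst j))) + size (e (fst j)) + 1)"
    by (intro poly_bounded_add poly_bounded_const poly_bounded_reindex[OF polytime_output[OF xs]]
        poly_bounded_reindex[OF polytime_input[OF xs]]) (auto simp: D'_def)
  then have e': "polytime (D') ?\<kappa> e' e'"
    by (intro polytime_id, elim poly_bounded_mono)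
      (auto simp: e'_def D'_def size_elem_le_size_enc_list)
  have f: "polytime (D') ?\<kappa> e' (\<lambda>j. ey (f (fst j) (snd j)))"
  proof (rule step)
    show "polytime (D') ?\<kappa> e' (\<lambda>j. ex (snd j))"
      using polytime_left[OF e'] by (simp add: e'_def)
    show "polytime (D') ?\<kappa> e' (\<lambda>j. g (fst j))" if "polytime D \<kappa> e g" for g
    proof (rule polytime_comp)
      show "polytime (D') ?\<kappa> e' (\<lambda>j. e (fst j))"
        using polytime_right[OF e'] by (simp add: e'_def)
      show "polytime (D') ?\<kappa> (\<lambda>j. e (fst j)) (\<lambda>j. g (fst j))"
        by (rule polytime_reindex[OF that]) (auto simp: D'_def)
    qed
  qed
  \<comment> \<open>A bound on one image that is valid for all elements of a list; times the number
    of elements it bounds the whole accumulator.\<close>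
  obtain b where b: "poly_bounded D \<kappa> b" "\<And>j. j \<in> D' \<Longrightarrow> size (ey (f (fst j) (snd j))) \<le> b (fst j)"
    using poly_bounded_uniform[of D' \<kappa> fst _ D, OF polytime_output[OF f]] by metis
  define s where "s i k = enc_list ey (rev (map (f i) (take k (xs i))))" for i k
  have "polytime D \<kappa> e (\<lambda>i. s i (length (xs i)))"
  proof (rule polytime_iterate[OF xs])
    show "polytime D \<kappa> e (\<lambda>i. s i 0)"
      using polytime_Nil[OF xs] by (simp add: s_def)
    have "poly_bounded (SIGMA i:D. {..length (xs i)}) ?\<kappa>
        (\<lambda>j. length (xs (fst j)) * (b (fst j) + 1))"
      by (intro poly_bounded_mult poly_bounded_add poly_bounded_const
          poly_bounded_reindex[OF polytime_length[OF xs]] poly_bounded_reindex[OF b(1)]) auto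
    then show "poly_bounded (SIGMA i:D. {..length (xs i)}) ?\<kappa> (\<lambda>j. size (s (fst j) (snd j)))"
    proof (rule poly_bounded_mono)
      fix j assume j: "j \<in> (SIGMA i:D. {..length (xs i)})"
      have "size (enc_list ey (map (f (fst j)) (xs (fst j)))) \<le> length (map (f (fst j)) (xs (fst j))) * Suc (b (fst j))"
        using j b(2)[of "(fst j, _)"] by (intro size_enc_list_bound) (auto simp: D'_def)
      then show "size (s (fst j) (snd j)) \<le> length (xs (fst j)) * (b (fst j) + 1)"
        using size_enc_list_take[of ey "snd j" "map (f (fst j)) (xs (fst j))"]
        by (simp add: s_def take_map)
    qed
  next
    fix e''
    let ?D = "SIGMA i:D. {..<length (xs i)}"
    assume x: "polytime ?D ?\<kappa> e'' (\<lambda>j. ex (xs (fst j) ! snd j))"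
      and s: "polytime ?D ?\<kappa> e'' (\<lambda>j. s (fst j) (snd j))"
      and up: "\<And>g. polytime D \<kappa> e g \<Longrightarrow> polytime ?D ?\<kappa> e'' (\<lambda>j. g (fst j))"
    \<comment> \<open>Passes from positions, by which \<open>polytime_iterate\<close> indexes the
      rounds, to elements, by which the fact \<open>f\<close> is indexed.\<close>
    let ?h = "\<lambda>j. (fst j, xs (fst j) ! snd j)"
    have "polytime ?D ?\<kappa> e'' (\<lambda>j. e' (?h j))"
      unfolding e'_def fst_conv snd_conv by (rule polytime_pair[OF x up[OF e]])
    then have y: "polytime ?D ?\<kappa> e'' (\<lambda>j. ey (f (fst j) (xs (fst j) ! snd j)))"
      using polytime_reindex[OF f, of ?D ?h] by (auto simp: D'_def intro: polytime_comp)
    show "polytime ?D ?\<kappa> e'' (\<lambda>j. s (fst j) (Suc (snd j)))"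
      by (rule polytime_cong[OF polytime_pair[OF y s]]) (auto simp: s_def take_Suc_conv_app_nth)
  qed
  from polytime_rev[OF this[unfolded s_def]] show ?thesis
    by simp
qed

lemma polytime_concat:
  assumes xs: "polytime D \<kappa> e (\<lambda>i. enc_list (enc_list ex) (xs i))"
  shows "polytime D \<kappa> e (\<lambda>i. enc_list ex (concat (xs i)))"
proof -
  define s where "s i k = enc_list ex (concat (take k (xs i)))" for i k
  have "polytime D \<kappa> e (\<lambda>i. s i (length (xs i)))"
  proof (rule polytime_iterate[OF xs])
    show "polytime D \<kappa> e (\<lambda>i. s i 0)"
      using polytime_Nil[OF xs] by (simp add: s_def)
    have le: "size (enc_list ex (concat ys)) \<le> size (enc_list (enc_list ex) ys)" for ys
      by (induction ys) auto
    have "poly_bounded (SIGMA i:D. {..length (xs i)}) (\<lambda>j. \<kappa> (fst j))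
        (\<lambda>j. size (enc_list (enc_list ex) (xs (fst j))))"
      by (intro poly_bounded_reindex[OF polytime_output[OF xs]]) auto
    then show "poly_bounded (SIGMA i:D. {..length (xs i)}) (\<lambda>j. \<kappa> (fst j)) (\<lambda>j. size (s (fst j) (snd j)))"
      by (rule poly_bounded_mono) (auto simp: s_def intro: order_trans[OF le size_enc_list_take])
  next
    fix e'
    let ?D = "SIGMA i:D. {..<length (xs i)}"
    assume x: "polytime ?D (\<lambda>j. \<kappa> (fst j)) e' (\<lambda>j. enc_list ex (xs (fst j) ! snd j))"
      and s: "polytime ?D (\<lambda>j. \<kappa> (fst j)) e' (\<lambda>j. s (fst j) (snd j))"
    show "polytime ?D (\<lambda>j. \<kappa> (fst j)) e' (\<lambda>j. s (fst j) (Suc (snd j)))"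
      by (rule polytime_cong[OF polytime_append[OF s[unfolded s_def] x]])
        (auto simp: s_def take_Suc_conv_app_nth)
  qed
  then show ?thesis
    by (simp add: s_def)
qed

lemma polytime_filter:
  fixes xs :: "'i \<Rightarrow> 'x list" and D :: "'i set"
  defines "D' \<equiv> Sigma D (\<lambda>i. set (xs i))"
  assumes xs: "polytime D \<kappa> e (\<lambda>i. enc_list ex (xs i))"
    and step: "\<And>e'. polytime (D') (\<lambda>j. \<kappa> (fst j)) e' (\<lambda>j. ex (snd j)) \<Longrightarrow>
      (\<And>g. polytime D \<kappa> e g \<Longrightarrow> polytime (D') (\<lambda>j. \<kappa> (fst j)) e' (\<lambda>j. g (fst j))) \<Longrightarrow>
      polytime (D') (\<lambda>j. \<kappa> (fst j)) e' (\<lambda>j. enc_bool (P (fst j) (snd j)))"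
  shows "polytime D \<kappa> e (\<lambda>i. enc_list ex (filter (P i) (xs i)))"
proof -
  have "polytime D \<kappa> e (\<lambda>i. enc_list (enc_list ex) (map (\<lambda>x. if P i x then [x] else []) (xs i)))"
  proof (rule polytime_map[OF xs])
    fix e'
    let ?D = "Sigma D (\<lambda>i. set (xs i))"
    assume x: "polytime ?D (\<lambda>j. \<kappa> (fst j)) e' (\<lambda>j. ex (snd j))"
      and up: "\<And>g. polytime D \<kappa> e g \<Longrightarrow> polytime ?D (\<lambda>j. \<kappa> (fst j)) e' (\<lambda>j. g (fst j))"
    have "polytime ?D (\<lambda>j. \<kappa> (fst j)) e'
        (\<lambda>j. if P (fst j) (snd j) then Node (ex (snd j)) Leaf else Leaf)"
    proof (rule polytime_if)
      show "polytime ?D (\<lambda>j. \<kappa> (fst j)) e' (\<lambda>j. enc_bool (P (fst j) (snd j)))"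
        by (rule step[unfolded D'_def]) (rule x, rule up)
    qed (rule polytime_subset[OF polytime_pair[OF x polytime_const'[OF x]]], blast,
        rule polytime_subset[OF polytime_const'[OF x]], blast)
    then show "polytime ?D (\<lambda>j. \<kappa> (fst j)) e' (\<lambda>j. enc_list ex (if P (fst j) (snd j) then [snd j] else []))"
      by (rule polytime_cong) simp
  qed
  moreover have "concat (map (\<lambda>x. if p x then [x] else []) ys) = filter p ys" for p :: "'x \<Rightarrow> bool" and ys
    by (induction ys) simp_all
  ultimately show ?thesis
    using polytime_concat by fastforce
qed

section \<open>Boolean connectives, bounded quantifiers and further list functions\<close>

lemma polytime_not:
  assumes "polytime D \<kappa> e (\<lambda>i. enc_bool (b i))"
  shows "polytime D \<kappa> e (\<lambda>i. enc_bool (\<not> b i))"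
proof -
  have "polytime D \<kappa> e (\<lambda>i. if b i then enc_bool False else enc_bool True)"
    by (rule polytime_if[OF assms]) (rule polytime_subset[OF polytime_const'[OF assms]], blast)+
  then show ?thesis by (rule polytime_cong) simp
qed

lemma polytime_conj:
  assumes "polytime D \<kappa> e (\<lambda>i. enc_bool (b i))" and "polytime {i \<in> D. b i} \<kappa> e (\<lambda>i. enc_bool (c i))"
  shows "polytime D \<kappa> e (\<lambda>i. enc_bool (b i \<and> c i))"
proof -
  have "polytime D \<kappa> e (\<lambda>i. if b i then enc_bool (c i) else enc_bool False)"
    by (rule polytime_if[OF assms]) (rule polytime_subset[OF polytime_const'[OF assms(1)]], blast)
  then show ?thesis by (rule polytime_cong) simp
qed

lemma polytime_conj':
  assumes "polytime D \<kappa> e (\<lambda>i. enc_bool (b i))" and "polytime D \<kappa> e (\<lambda>i. enc_bool (c i))"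
  shows "polytime D \<kappa> e (\<lambda>i. enc_bool (b i \<and> c i))"
  by (rule polytime_conj[OF assms(1) polytime_subset[OF assms(2)]]) blast

lemma polytime_null:
  assumes "polytime D \<kappa> e (\<lambda>i. enc_list ex (xs i))"
  shows "polytime D \<kappa> e (\<lambda>i. enc_bool (xs i = []))"
  using polytime_not[OF polytime_nonleaf[OF assms]] by simp

lemma polytime_ex:
  fixes xs :: "'i \<Rightarrow> 'x list" and D :: "'i set"
  defines "D' \<equiv> Sigma D (\<lambda>i. set (xs i))"
  assumes xs: "polytime D \<kappa> e (\<lambda>i. enc_list ex (xs i))"
    and step: "\<And>e'. polytime (D') (\<lambda>j. \<kappa> (fst j)) e' (\<lambda>j. ex (snd j)) \<Longrightarrow>
      (\<And>g. polytime D \<kappa> e g \<Longrightarrow> polytime (D') (\<lambda>j. \<kappa> (fst j)) e' (\<lambda>j. g (fst j))) \<Longrightarrow>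
      polytime (D') (\<lambda>j. \<kappa> (fst j)) e' (\<lambda>j. enc_bool (P (fst j) (snd j)))"
  shows "polytime D \<kappa> e (\<lambda>i. enc_bool (\<exists>x\<in>set (xs i). P i x))"
  using polytime_not[OF polytime_null[OF polytime_filter[OF xs step[unfolded D'_def]]]]
  by (simp add: filter_empty_conv)

lemma polytime_all:
  fixes xs :: "'i \<Rightarrow> 'x list" and D :: "'i set"
  defines "D' \<equiv> Sigma D (\<lambda>i. set (xs i))"
  assumes xs: "polytime D \<kappa> e (\<lambda>i. enc_list ex (xs i))"
    and step: "\<And>e'. polytime (D') (\<lambda>j. \<kappa> (fst j)) e' (\<lambda>j. ex (snd j)) \<Longrightarrow>
      (\<And>g. polytime D \<kappa> e g \<Longrightarrow> polytime (D') (\<lambda>j. \<kappa> (fst j)) e' (\<lambda>j. g (fst j))) \<Longrightarrow>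
      polytime (D') (\<lambda>j. \<kappa> (fst j)) e' (\<lambda>j. enc_bool (P (fst j) (snd j)))"
  shows "polytime D \<kappa> e (\<lambda>i. enc_bool (\<forall>x\<in>set (xs i). P i x))"
proof -
  have "polytime D \<kappa> e (\<lambda>i. enc_bool (\<exists>x\<in>set (xs i). \<not> P i x))"
    by (rule polytime_ex[OF xs polytime_not[OF step[unfolded D'_def]]])
  from polytime_not[OF this] show ?thesis by simp
qed

lemma polytime_zip:
  assumes xs: "polytime D \<kappa> e (\<lambda>i. enc_list ex (xs i))" and ys: "polytime D \<kappa> e (\<lambda>i. enc_list ey (ys i))"
    and len: "\<And>i. i \<in> D \<Longrightarrow> length (xs i) = length (ys i)"
  shows "polytime D \<kappa> e (\<lambda>i. enc_list (\<lambda>p. Node (ex (fst p)) (ey (snd p))) (zip (xs i) (ys i)))"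
proof -
  let ?ep = "\<lambda>p. Node (ex (fst p)) (ey (snd p))"
  define s where "s i k = Node (enc_list ey (drop k (ys i)))
    (enc_list ?ep (rev (take k (zip (xs i) (ys i)))))" for i k
  have "polytime D \<kappa> e (\<lambda>i. s i (length (xs i)))"
  proof (rule polytime_iterate[OF xs])
    show "polytime D \<kappa> e (\<lambda>i. s i 0)"
      unfolding s_def using polytime_pair[OF ys polytime_const'[OF xs, of Leaf]] by simp
    have le: "size (enc_list ?ep (zip us vs)) \<le> size (enc_list ex us) + size (enc_list ey vs)" for us vs
      by (induction us vs rule: list_induct2') auto
    have "poly_bounded (SIGMA i:D. {..length (xs i)}) (\<lambda>j. \<kappa> (fst j))
        (\<lambda>j. size (enc_list ey (ys (fst j))) + (size (enc_list ex (xs (fst j))) + size (enc_list ey (ys (fst j)))) + 1)"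
      by (intro poly_bounded_add poly_bounded_const poly_bounded_reindex[OF polytime_output[OF xs]]
          poly_bounded_reindex[OF polytime_output[OF ys]]) auto
    then show "poly_bounded (SIGMA i:D. {..length (xs i)}) (\<lambda>j. \<kappa> (fst j)) (\<lambda>j. size (s (fst j) (snd j)))"
      by (rule poly_bounded_mono)
        (auto simp: s_def intro!: add_mono size_enc_list_drop order_trans[OF size_enc_list_take le])
  next
    fix e'
    let ?D = "SIGMA i:D. {..<length (xs i)}"
    assume x: "polytime ?D (\<lambda>j. \<kappa> (fst j)) e' (\<lambda>j. ex (xs (fst j) ! snd j))"
      and s: "polytime ?D (\<lambda>j. \<kappa> (fst j)) e' (\<lambda>j. s (fst j) (snd j))"
    note s1 = polytime_fst[OF s[unfolded s_def]] and s2 = polytime_snd[OF s[unfolded s_def]]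
    show "polytime ?D (\<lambda>j. \<kappa> (fst j)) e' (\<lambda>j. s (fst j) (Suc (snd j)))"
      by (rule polytime_cong[OF polytime_pair[OF polytime_right[OF s1]
              polytime_pair[OF polytime_pair[OF x polytime_left[OF s1]] s2]]])
        (auto simp: s_def take_Suc_conv_app_nth right_enc_list left_enc_list hd_drop_conv_nth tl_drop drop_Suc len)
  qed
  from polytime_rev[OF polytime_snd[OF this[unfolded s_def]]] show ?thesis
    by (rule polytime_cong) (simp add: len)
qed

lemma polytime_take_1:
  assumes "polytime D \<kappa> e (\<lambda>i. enc_list ex (xs i))"
  shows "polytime D \<kappa> e (\<lambda>i. enc_list ex (take 1 (xs i)))"
proof -
  have "polytime D \<kappa> e (\<lambda>i. if xs i = [] then Leaf else Node (left (enc_list ex (xs i))) Leaf)"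
    by (rule polytime_if[OF polytime_null[OF assms]])
      (rule polytime_subset[OF polytime_const'[OF assms]]
        polytime_subset[OF polytime_pair[OF polytime_left[OF assms] polytime_const'[OF assms]]], blast)+
  moreover have "(if ys = [] then Leaf else Node (left (enc_list ex ys)) Leaf) = enc_list ex (take 1 ys)" for ys
    by (cases ys) simp_all
  ultimately show ?thesis by simp
qed

subsection \<open>Numbers\<close>

fun bits :: "nat \<Rightarrow> bool list" where
  "bits n = (if n = 0 then [] else odd n # bits (n div 2))"

declare bits.simps [simp del]

text \<open>Turns binary numbers into lists, so that loops over lists can carry out
  arithmetic.\<close>

lemma enc_nat_bits: "enc_nat n = enc_list enc_bool (bits n)"
proof (induction n rule: less_induct)
  case (less n)
  then show ?case
    by (cases "n = 0") (simp_all add: enc_nat.simps[of n] bits.simps[of n] enc_nat.simps[of 0] bits.simps[of 0])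
qed

lemma enc_bool_inject [simp]: "enc_bool a = enc_bool b \<longleftrightarrow> a = b"
  by (simp add: enc_bool_def)

lemma enc_bool_eq_Leaf [simp]: "enc_bool a = Leaf \<longleftrightarrow> \<not> a"
  by (simp add: enc_bool_def)

lemma bits_inject [simp]: "bits m = bits n \<longleftrightarrow> m = n"
  by (metis enc_nat_bits enc_nat_inject)

lemma length_bits_le: "length (bits n) \<le> n"
proof (induction n rule: less_induct)
  case (less n)
  show ?case
  proof (cases "n = 0")
    case False
    then have "length (bits (n div 2)) \<le> n div 2"
      using less by simp
    then show ?thesis
      using False by (simp add: bits.simps[of n])
  qed (simp add: bits.simps)
qed

lemma less_power_length_bits: "n < 2 ^ length (bits n)"
proof (induction n rule: less_induct)
  case (less n)
  show ?case
  proof (cases "n = 0")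
    case False
    then have "n div 2 < 2 ^ length (bits (n div 2))"
      using less by simp
    then show ?thesis
      using False by (simp add: bits.simps[of n])
  qed (simp add: bits.simps)
qed

lemma bits_double: "n > 0 \<Longrightarrow> bits (2 * n) = False # bits n"
  by (simp add: bits.simps[of "2 * n"])

lemma bits_power_of_two: "bits (2 ^ k) = replicate k False @ [True]"
proof (induction k)
  case 0
  show ?case by (simp add: bits.simps)
qed (simp add: bits_double)

lemma enc_nat_double: "n > 0 \<Longrightarrow> enc_nat (2 * n) = Node Leaf (enc_nat n)"
  by (simp add: enc_nat_bits bits_double enc_bool_def)

lemma size_enc_nat: "size (enc_nat n) \<le> 2 * length (bits n)"
proof -
  have "size (enc_list enc_bool (bits n)) \<le> length (bits n) * Suc 1"
    by (intro size_enc_list_bound size_enc_bool)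
  then show ?thesis by (simp add: enc_nat_bits)
qed

text \<open>Ripple-carry increment, least significant bit first.\<close>

fun add_carry :: "bool \<Rightarrow> bool list \<Rightarrow> bool list" where
  "add_carry c [] = (if c then [True] else [])"
| "add_carry c (b # bs) = (b \<noteq> c) # add_carry (b \<and> c) bs"

lemma add_carry_False [simp]: "add_carry False bs = bs"
  by (induction bs) simp_all

lemma bits_Suc: "bits (Suc n) = add_carry True (bits n)"
proof (induction n rule: less_induct)
  case (less n)
  show ?case
  proof (cases "n = 0")
    case False
    then have "bits (Suc (n div 2)) = add_carry True (bits (n div 2))"
      using less by simp
    then show ?thesis
      using False by (cases "odd n") (simp_all add: bits.simps[of n] bits.simps[of "Suc n"])
  qed (simp add: bits.simps)
qed

lemma polytime_iff:
  assumes b: "polytime D \<kappa> e (\<lambda>i. enc_bool (b i))" and c: "polytime D \<kappa> e (\<lambda>i. enc_bool (c i))"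
  shows "polytime D \<kappa> e (\<lambda>i. enc_bool (b i = c i))"
proof -
  have "polytime D \<kappa> e (\<lambda>i. if b i then enc_bool (c i) else enc_bool (\<not> c i))"
    by (rule polytime_if[OF b]) (rule polytime_subset[OF c] polytime_subset[OF polytime_not[OF c]], blast)+
  then show ?thesis by (rule polytime_cong) simp
qed

lemma polytime_nat_eq:
  assumes "polytime D \<kappa> e (\<lambda>i. enc_nat (a i))" and "polytime D \<kappa> e (\<lambda>i. enc_nat (b i))"
  shows "polytime D \<kappa> e (\<lambda>i. enc_bool (a i = b i))"
proof -
  define xs ys where "xs i = bits (a i)" and "ys i = bits (b i)" for i
  from assms have xs: "polytime D \<kappa> e (\<lambda>i. enc_list enc_bool (xs i))"
    and ys: "polytime D \<kappa> e (\<lambda>i. enc_list enc_bool (ys i))"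
    by (simp_all add: enc_nat_bits xs_def ys_def)
  \<comment> \<open>The flag records whether the first \<open>k\<close> bits agree. Bit lists are
    canonical by \<open>bits_inject\<close>, so equality of the lists is equality of the
    numbers.\<close>
  define s where "s i k = Node (enc_list enc_bool (drop k (ys i)))
      (enc_bool (k \<le> length (ys i) \<and> take k (xs i) = take k (ys i)))" for i k
  have "polytime D \<kappa> e (\<lambda>i. s i (length (xs i)))"
  proof (rule polytime_iterate[OF xs])
    show "polytime D \<kappa> e (\<lambda>i. s i 0)"
      unfolding s_def using polytime_pair[OF ys polytime_const'[OF xs, of "enc_bool True"]] by simp
    have "poly_bounded (SIGMA i:D. {..length (xs i)}) (\<lambda>j. \<kappa> (fst j))
        (\<lambda>j. size (enc_list enc_bool (ys (fst j))) + 1 + Suc 0)"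
      by (intro poly_bounded_add poly_bounded_const poly_bounded_reindex[OF polytime_output[OF ys]]) auto
    then show "poly_bounded (SIGMA i:D. {..length (xs i)}) (\<lambda>j. \<kappa> (fst j)) (\<lambda>j. size (s (fst j) (snd j)))"
      unfolding s_def tree.size
      by (rule poly_bounded_mono) (intro add_mono size_enc_list_drop size_enc_bool order_refl)
  next
    fix e'
    let ?D = "SIGMA i:D. {..<length (xs i)}" and ?\<kappa> = "\<lambda>j. \<kappa> (fst j)"
    assume x: "polytime ?D ?\<kappa> e' (\<lambda>j. enc_bool (xs (fst j) ! snd j))"
      and s: "polytime ?D ?\<kappa> e' (\<lambda>j. s (fst j) (snd j))"
    note s1 = polytime_fst[OF s[unfolded s_def]] and s2 = polytime_snd[OF s[unfolded s_def]]
    have h: "polytime ?D ?\<kappa> e' (\<lambda>j. enc_bool ((xs (fst j) ! snd j) =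
        (left (enc_list enc_bool (drop (snd j) (ys (fst j)))) \<noteq> Leaf)))"
      by (rule polytime_iff[OF x polytime_nonleaf[OF polytime_left[OF s1]]])
    \<comment> \<open>\<open>left\<close> of an exhausted list is \<open>Leaf\<close>, which would
      read as a zero bit; the nonemptiness test keeps the flag true to its meaning.\<close>
    have "polytime ?D ?\<kappa> e' (\<lambda>j. Node (right (enc_list enc_bool (drop (snd j) (ys (fst j)))))
        (enc_bool ((snd j \<le> length (ys (fst j)) \<and> take (snd j) (xs (fst j)) = take (snd j) (ys (fst j))) \<and>
          (enc_list enc_bool (drop (snd j) (ys (fst j))) \<noteq> Leaf \<and> (xs (fst j) ! snd j) =
        (left (enc_list enc_bool (drop (snd j) (ys (fst j)))) \<noteq> Leaf)))))"
      by (rule polytime_pair[OF polytime_right[OF s1]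
            polytime_conj'[OF s2 polytime_conj'[OF polytime_nonleaf[OF s1] h]]])
    then show "polytime ?D ?\<kappa> e' (\<lambda>j. s (fst j) (Suc (snd j)))"
      by (rule polytime_cong) (auto simp: s_def take_Suc_conv_app_nth right_enc_list left_enc_list
          hd_drop_conv_nth tl_drop drop_Suc)
  qed
  note s = this[unfolded s_def]
  \<comment> \<open>Once all bits of \<open>a i\<close> are matched, only leftover bits of
    \<open>b i\<close> can still separate the numbers.\<close>
  from polytime_conj'[OF polytime_snd[OF s] polytime_not[OF polytime_nonleaf[OF polytime_fst[OF s]]]]
  show ?thesis
    by (rule polytime_cong) (auto simp: xs_def ys_def)
qed

lemma polytime_Suc:
  assumes "polytime D \<kappa> e (\<lambda>i. enc_nat (n i))"
  shows "polytime D \<kappa> e (\<lambda>i. enc_nat (Suc (n i)))"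
proof -
  define xs where "xs i = bits (n i)" for i
  from assms have xs: "polytime D \<kappa> e (\<lambda>i. enc_list enc_bool (xs i))"
    by (simp add: enc_nat_bits xs_def)
  define step :: "bool \<times> bool list \<Rightarrow> bool \<Rightarrow> bool \<times> bool list"
    where "step s b = (b \<and> fst s, (b \<noteq> fst s) # snd s)" for s b
  define c r where "c i k = fst (foldl step (True, []) (take k (xs i)))"
    and "r i k = snd (foldl step (True, []) (take k (xs i)))" for i k
  define s where "s i k = Node (enc_bool (c i k)) (enc_list enc_bool (r i k))" for i k
  have step_Suc: "c i (Suc k) = (xs i ! k \<and> c i k)" "r i (Suc k) = (xs i ! k \<noteq> c i k) # r i k"
    if "k < length (xs i)" for i k
    using that by (simp_all add: c_def r_def take_Suc_conv_app_nth step_def)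
  have len: "length (r i k) \<le> k" for i k
  proof -
    have "length (snd (foldl step p ys)) = length ys + length (snd p)" for p ys
      by (induction ys arbitrary: p) (simp_all add: step_def)
    then show ?thesis by (simp add: r_def)
  qed
  \<comment> \<open>Generalised over the start state \<open>p\<close> for the induction along
    \<open>foldl\<close>. At \<open>(True, [])\<close> it says that the reversed digits followed by
    the final carry form the successor.\<close>
  have carry: "rev (snd (foldl step p ys)) @ (if fst (foldl step p ys) then [True] else []) =
      rev (snd p) @ add_carry (fst p) ys" for p ys
    by (induction ys arbitrary: p) (simp_all add: step_def)
  have "polytime D \<kappa> e (\<lambda>i. s i (length (xs i)))"
  proof (rule polytime_iterate[OF xs])
    show "polytime D \<kappa> e (\<lambda>i. s i 0)"
      using polytime_const'[OF xs, of "Node (enc_bool True) Leaf"] by (simp add: s_def c_def r_def)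
    have "poly_bounded (SIGMA i:D. {..length (xs i)}) (\<lambda>j. \<kappa> (fst j)) (\<lambda>j. length (xs (fst j)) * 2 + 1 + 1)"
      by (intro poly_bounded_add poly_bounded_mult poly_bounded_const
          poly_bounded_reindex[OF polytime_length[OF xs]]) auto
    then show "poly_bounded (SIGMA i:D. {..length (xs i)}) (\<lambda>j. \<kappa> (fst j)) (\<lambda>j. size (s (fst j) (snd j)))"
    proof (rule poly_bounded_mono)
      fix j assume "j \<in> (SIGMA i:D. {..length (xs i)})"
      then have "length (r (fst j) (snd j)) \<le> length (xs (fst j))"
        using len[of "fst j" "snd j"] by auto
      moreover have "size (enc_list enc_bool (r (fst j) (snd j))) \<le> length (r (fst j) (snd j)) * Suc 1"
        by (intro size_enc_list_bound size_enc_bool)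
      ultimately show "size (s (fst j) (snd j)) \<le> length (xs (fst j)) * 2 + 1 + 1"
        using size_enc_bool[of "c (fst j) (snd j)"] by (simp add: s_def)
    qed
  next
    fix e'
    let ?D = "SIGMA i:D. {..<length (xs i)}" and ?\<kappa> = "\<lambda>j. \<kappa> (fst j)"
    assume x: "polytime ?D ?\<kappa> e' (\<lambda>j. enc_bool (xs (fst j) ! snd j))"
      and s: "polytime ?D ?\<kappa> e' (\<lambda>j. s (fst j) (snd j))"
    note s1 = polytime_fst[OF s[unfolded s_def]] and s2 = polytime_snd[OF s[unfolded s_def]]
    have "polytime ?D ?\<kappa> e' (\<lambda>j. Node (enc_bool (xs (fst j) ! snd j \<and> c (fst j) (snd j)))
        (Node (enc_bool (\<not> (xs (fst j) ! snd j = c (fst j) (snd j)))) (enc_list enc_bool (r (fst j) (snd j)))))"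
      by (intro polytime_pair polytime_conj' polytime_not polytime_iff x s1 s2)
    then show "polytime ?D ?\<kappa> e' (\<lambda>j. s (fst j) (Suc (snd j)))"
      by (rule polytime_cong) (auto simp: s_def step_Suc)
  qed
  note s = this[unfolded s_def]
  have "polytime D \<kappa> e (\<lambda>i. if c i (length (xs i)) then enc_list enc_bool [True] else enc_list enc_bool [])"
    by (rule polytime_if[OF polytime_fst[OF s]])
      (rule polytime_subset[OF polytime_const'[OF xs]], blast)+
  then have "polytime D \<kappa> e (\<lambda>i. enc_list enc_bool (if c i (length (xs i)) then [True] else []))"
    by (rule polytime_cong) simp
  from polytime_append[OF polytime_rev[OF polytime_snd[OF s]] this]
  show ?thesis
    by (rule polytime_cong) (use carry[of "(True, [])"] in \<open>simp add: enc_nat_bits bits_Suc xs_def c_def r_def\<close>)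
qed

text \<open>The count is given in binary but the output is unary in it; hence its value, and not
  just its code, has to be polynomially bounded.\<close>

lemma polytime_replicate:
  assumes n: "polytime D \<kappa> e (\<lambda>i. enc_nat (n i))" and a: "polytime D \<kappa> e (\<lambda>i. ex (a i))"
    and bound: "poly_bounded D \<kappa> n"
  shows "polytime D \<kappa> e (\<lambda>i. enc_list ex (replicate (n i) (a i)))"
proof -
  let ?\<kappa> = "\<lambda>j. \<kappa> (fst j)"
  define st where "st i k = Node (enc_nat k) (Node (enc_list ex (replicate k (a i))) (e i))" for i k
  have e: "polytime D \<kappa> e e"
    by (rule polytime_id[OF polytime_input[OF n]])
  let ?D = "SIGMA i:D. {..n i}"
  have "poly_bounded ?D ?\<kappa> (\<lambda>j. 2 * n (fst j) + (n (fst j) * (size (ex (a (fst j))) + 1) + size (e (fst j)) + 1) + 1)"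
    by (intro poly_bounded_add poly_bounded_mult poly_bounded_const poly_bounded_reindex[OF bound]
        poly_bounded_reindex[OF polytime_output[OF a]] poly_bounded_reindex[OF polytime_input[OF a]]) auto
  then have "poly_bounded ?D ?\<kappa> (\<lambda>j. size (st (fst j) (snd j)))"
  proof (rule poly_bounded_mono)
    fix j assume "j \<in> ?D"
    then have k: "snd j \<le> n (fst j)" by auto
    have "size (enc_nat (snd j)) \<le> 2 * n (fst j)"
      using size_enc_nat[of "snd j"] length_bits_le[of "snd j"] k by linarith
    moreover have "size (enc_list ex (replicate (snd j) (a (fst j)))) \<le> snd j * Suc (size (ex (a (fst j))))"
      using size_enc_list_bound[of "replicate (snd j) (a (fst j))" ex] by simp
    moreover have "\<dots> \<le> n (fst j) * Suc (size (ex (a (fst j))))"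
      using k by (rule mult_le_mono1)
    ultimately show "size (st (fst j) (snd j)) \<le>
        2 * n (fst j) + (n (fst j) * (size (ex (a (fst j))) + 1) + size (e (fst j)) + 1) + 1"
      by (simp add: st_def)
  qed
  then have st: "polytime ?D ?\<kappa> (\<lambda>j. st (fst j) (snd j)) (\<lambda>j. st (fst j) (snd j))"
    by (rule polytime_id)
  note st' = st[unfolded st_def]
  have up: "polytime ?D ?\<kappa> (\<lambda>j. st (fst j) (snd j)) (\<lambda>j. g (fst j))" if "polytime D \<kappa> e g" for g
    unfolding st_def
    by (rule polytime_comp[OF polytime_snd[OF polytime_snd[OF st']]], rule polytime_reindex[OF that]) auto
  have "polytime D \<kappa> e (\<lambda>i. st i (n i))"
  proof (rule polytime_while)
    show "polytime D \<kappa> e (\<lambda>i. st i 0)"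
      unfolding st_def using polytime_pair[OF polytime_const'[OF n] polytime_pair[OF polytime_const'[OF n] e]]
      by simp
    \<comment> \<open>The counter never exceeds \<open>n i\<close>, so the comparison reduces to an
      equality test.\<close>
    show "polytime ?D ?\<kappa> (\<lambda>j. st (fst j) (snd j)) (\<lambda>j. enc_bool (snd j < n (fst j)))"
      unfolding st_def
      by (rule polytime_cong[OF polytime_not[OF polytime_nat_eq[OF polytime_fst[OF st'] up[OF n, unfolded st_def]]]])
        (auto intro!: arg_cong[where f = enc_bool])
    have "polytime ?D ?\<kappa> (\<lambda>j. st (fst j) (snd j)) (\<lambda>j. st (fst j) (Suc (snd j)))"
      unfolding st_def replicate_Suc enc_list_Cons
      by (intro polytime_pair polytime_Suc polytime_fst[OF st'] polytime_fst[OF polytime_snd[OF st']]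
          polytime_snd[OF polytime_snd[OF st']] up[OF a, unfolded st_def])
    then show "polytime (SIGMA i:D. {..<n i}) ?\<kappa> (\<lambda>j. st (fst j) (snd j)) (\<lambda>j. st (fst j) (Suc (snd j)))"
      by (rule polytime_subset) auto
  qed (rule bound)
  from polytime_fst[OF polytime_snd[OF this[unfolded st_def]]] show ?thesis .
qed

lemma polytime_member:
  assumes "polytime D \<kappa> e (\<lambda>i. enc_nat (x i))" and "polytime D \<kappa> e (\<lambda>i. enc_list enc_nat (ys i))"
  shows "polytime D \<kappa> e (\<lambda>i. enc_bool (x i \<in> set (ys i)))"
proof -
  have "polytime D \<kappa> e (\<lambda>i. enc_bool (\<exists>y\<in>set (ys i). x i = y))"
  proof (rule polytime_ex[OF assms(2)])
    fix e'
    let ?D = "SIGMA i:D. set (ys i)" and ?\<kappa> = "\<lambda>j. \<kappa> (fst j)"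
    assume y: "polytime ?D ?\<kappa> e' (\<lambda>j. enc_nat (snd j))"
      and up: "\<And>g. polytime D \<kappa> e g \<Longrightarrow> polytime ?D ?\<kappa> e' (\<lambda>j. g (fst j))"
    show "polytime ?D ?\<kappa> e' (\<lambda>j. enc_bool (x (fst j) = snd j))"
      by (rule polytime_nat_eq[OF up[OF assms(1)] y])
  qed
  then show ?thesis by simp
qed

lemma enc_nat_mult_power:
  "c > 0 \<Longrightarrow> enc_nat (c * 2 ^ Suc k) = Node Leaf (enc_nat (c * 2 ^ k))"
  using enc_nat_double[of "c * 2 ^ k"] by (simp add: mult.left_commute)

lemma size_enc_nat_mult_power: "c > 0 \<Longrightarrow> size (enc_nat (c * 2 ^ k)) = size (enc_nat c) + k"
  by (induction k) (simp_all add: enc_nat_mult_power del: power_Suc)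

text \<open>Doubling prepends a zero bit, so many distinct numbers arise without a multiplication
  program, each of size only one more than the one before. For 0 the extra bit would give a tree
  that is no code of a number, hence \<open>pos\<close>. The list \<open>xs\<close> serves as a
  unary clock.\<close>

lemma polytime_doublings:
  assumes xs: "polytime D \<kappa> e (\<lambda>i. enc_list ex (xs i))" and c: "polytime D \<kappa> e (\<lambda>i. enc_nat (c i))"
    and pos: "\<And>i. i \<in> D \<Longrightarrow> c i > 0"
  shows "polytime D \<kappa> e (\<lambda>i. enc_list enc_nat (map (\<lambda>k. c i * 2 ^ k) [0..<length (xs i)]))"
proof -
  define s where "s i k = Node (enc_nat (c i * 2 ^ k))
    (enc_list enc_nat (rev (map (\<lambda>k. c i * 2 ^ k) [0..<k])))" for i k
  have "polytime D \<kappa> e (\<lambda>i. s i (length (xs i)))"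
  proof (rule polytime_iterate[OF xs])
    let ?D = "SIGMA i:D. {..length (xs i)}" and ?\<kappa> = "\<lambda>j. \<kappa> (fst j)"
    let ?b = "\<lambda>j. size (enc_nat (c (fst j))) + length (xs (fst j))"
    show "polytime D \<kappa> e (\<lambda>i. s i 0)"
      unfolding s_def using polytime_pair[OF c polytime_const'[OF xs, of Leaf]] by simp
    have "poly_bounded ?D ?\<kappa> (\<lambda>j. ?b j + length (xs (fst j)) * (?b j + 1) + 1)"
      by (intro poly_bounded_add poly_bounded_mult poly_bounded_const
          poly_bounded_reindex[OF polytime_length[OF xs]] poly_bounded_reindex[OF polytime_output[OF c]]) auto
    then show "poly_bounded ?D ?\<kappa> (\<lambda>j. size (s (fst j) (snd j)))"
    proof (rule poly_bounded_mono)
      fix j assume j: "j \<in> ?D"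
      let ?zs = "map (\<lambda>k. c (fst j) * 2 ^ k) [0..<snd j]"
      have b: "size (enc_nat (c (fst j) * 2 ^ k)) \<le> ?b j" if "k \<le> snd j" for k
        using that j pos size_enc_nat_mult_power by auto
      then have "size (enc_list enc_nat ?zs) \<le> length ?zs * Suc (?b j)"
        by (intro size_enc_list_bound) auto
      also have "\<dots> \<le> length (xs (fst j)) * Suc (?b j)"
        using j by (intro mult_le_mono1) auto
      finally show "size (s (fst j) (snd j)) \<le> ?b j + length (xs (fst j)) * (?b j + 1) + 1"
        using b[OF order_refl] by (simp add: s_def)
    qed
  next
    fix e'
    let ?D = "SIGMA i:D. {..<length (xs i)}"
    assume s: "polytime ?D (\<lambda>j. \<kappa> (fst j)) e' (\<lambda>j. s (fst j) (snd j))"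
    note s1 = polytime_fst[OF s[unfolded s_def]] and s2 = polytime_snd[OF s[unfolded s_def]]
    show "polytime ?D (\<lambda>j. \<kappa> (fst j)) e' (\<lambda>j. s (fst j) (Suc (snd j)))"
      by (rule polytime_cong[OF polytime_pair[OF polytime_pair[OF polytime_const'[OF s] s1] polytime_pair[OF s1 s2]]])
        (auto simp: s_def enc_nat_mult_power pos simp del: power_Suc)
  qed
  from polytime_rev[OF polytime_snd[OF this[unfolded s_def]]] show ?thesis
    by simp
qed

section \<open>The reduction\<close>

text \<open>The name of a group is one of its facilities. Groups can then be enumerated as the fixed
  points of this map among the facilities.\<close>

definition representative :: "'r pcm \<Rightarrow> nat \<Rightarrow> nat" where
  "representative J f = (case filter (\<lambda>A. f \<in> set A) (parts J) of [] \<Rightarrow> f | A # _ \<Rightarrow> hd A)"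

text \<open>Entry \<open>k\<close> is the group of client \<open>k\<close>. Only fixed points of
  \<open>representative\<close> contribute, so the value of a group is counted once, however many
  facilities it has.\<close>

definition tags :: "'r pcm \<Rightarrow> nat list" where
  "tags J = concat (map (\<lambda>f. replicate (if representative J f = f then val J f else 0) f) (facilities J))"

text \<open>
  The clients are named \<open>offset J * 2 ^ k\<close>: as bit lists these differ only by leading zeros, and the
  offset exceeds every facility.
\<close>

definition offset :: "'r pcm \<Rightarrow> nat" where
  "offset J = 2 ^ length (concat (map bits (facilities J)))"

definition tagged_clients :: "'r pcm \<Rightarrow> (nat \<times> nat) list" where
  "tagged_clients J = map (\<lambda>k. (offset J * 2 ^ k, tags J ! k)) [0..<length (tags J)]"

text \<open>Tags travel with the points, so that a program can compare them without a lookup. The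
  order is that of the rows of the distance matrix in \<open>enc_supplier\<close>.\<close>

definition tagged_points :: "'r pcm \<Rightarrow> (nat \<times> nat) list" where
  "tagged_points J = map (\<lambda>f. (f, representative J f)) (facilities J) @ tagged_clients J"

definition tag :: "'r pcm \<Rightarrow> nat \<Rightarrow> nat" where
  "tag J u = the (map_of (tagged_points J) u)"

text \<open>The distance inside a group is 1 and not 0 because \<open>metric_on\<close> separates
  distinct points.\<close>

definition supplier_of :: "'r pcm \<Rightarrow> nat \<Rightarrow> 'r supplier" where
  "supplier_of J m = \<lparr>facilities = facilities J, family = family J, clients = map fst (tagged_clients J),
    distance = (\<lambda>u v. if u = v then Some 0 else if tag J u = tag J v then Some 1 else None),
    demand = m\<rparr>"

lemma supplier_of_simps [simp]:
  "facilities (supplier_of J m) = facilities J"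
  "family (supplier_of J m) = family J"
  "clients (supplier_of J m) = map fst (tagged_clients J)"
  "distance (supplier_of J m) u v = (if u = v then Some 0 else if tag J u = tag J v then Some 1 else None)"
  "demand (supplier_of J m) = m"
  by (simp_all add: supplier_of_def)

text \<open>An \<open>r\<close> that represents no entry of \<open>xs\<close> contributes nothing,
  so it is safe to run over all facilities instead of the groups.\<close>

definition prune :: "'r pcm \<Rightarrow> nat list \<Rightarrow> nat list" where
  "prune J xs = concat (map (\<lambda>r. take 1 (filter (\<lambda>f. representative J f = r) xs)) (facilities J))"

text \<open>A substitute for testing finite cost that merely scans listed pairs and compares
  numbers; \<open>covered_iff\<close> relates it to \<open>tag\<close>.\<close>

definition covered :: "'r pcm \<Rightarrow> nat list \<Rightarrow> nat list \<Rightarrow> bool" where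
  "covered J xs ys \<longleftrightarrow> (\<forall>u\<in>set ys. \<exists>p\<in>set (tagged_points J). \<exists>q\<in>set (tagged_points J).
    fst p = u \<and> fst q \<in> set xs \<and> snd p = snd q)"

text \<open>The recursion prefers the largest successful demand; computed upwards, each success
  overwrites the earlier ones. The initial \<open>[]\<close> stands for the empty set, which lies in
  every nonempty down-closed family and settles demand 0.\<close>

fun best :: "'r pcm \<Rightarrow> (nat \<Rightarrow> nat list \<times> nat list) \<Rightarrow> nat \<Rightarrow> nat list" where
  "best J out 0 = []"
| "best J out (Suc k) = (if covered J (fst (out (Suc k))) (snd (out (Suc k)))
    then fst (out (Suc k)) else best J out k)"

lemma pt_dist_supplier_of:
  "pt_dist (supplier_of J m) u v = (if u = v then 0 else if tag J u = tag J v then 1 else \<infinity>)"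
  by (simp add: pt_dist_def)

lemma set_take_1: "set (take 1 xs) = (if xs = [] then {} else {hd xs})"
  by (cases xs) simp_all

section \<open>Correctness: groups and their representatives\<close>

context
  fixes R :: "'r representation" and b :: "nat poly" and J :: "'r pcm"
  assumes J: "pcm_instance R b J"
begin

lemma part_unique:
  assumes "A \<in> set (parts J)" "B \<in> set (parts J)" "f \<in> set A" "f \<in> set B"
  shows "A = B"
proof -
  from J have "distinct (concat (parts J))" by (simp add: pcm_instance_def)
  with assms show ?thesis unfolding distinct_concat_iff by blast
qed

lemma representative_part:
  assumes "A \<in> set (parts J)" "f \<in> set A"
  shows "representative J f = hd A"
proof -
  let ?As = "filter (\<lambda>A. f \<in> set A) (parts J)"
  from assms have "A \<in> set ?As" by simp
  then obtain B Bs where B: "?As = B # Bs" by (cases ?As) auto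
  then have "B \<in> set ?As" by simp
  then have "B = A"
    using part_unique[OF _ assms(1) _ assms(2)] by simp
  with B show ?thesis by (simp add: representative_def)
qed

lemma representative_no_part:
  assumes "\<And>A. A \<in> set (parts J) \<Longrightarrow> f \<notin> set A"
  shows "representative J f = f"
proof -
  from assms have "filter (\<lambda>A. f \<in> set A) (parts J) = []" by (simp add: filter_empty_conv)
  then show ?thesis by (simp add: representative_def)
qed

lemma representative_cases:
  obtains (part) A where "A \<in> set (parts J)" "f \<in> set A" "representative J f = hd A" "hd A \<in> set A"
  | (no_part) "representative J f = f" "\<And>A. A \<in> set (parts J) \<Longrightarrow> f \<notin> set A"
proof (cases "\<exists>A\<in>set (parts J). f \<in> set A")
  case True
  then obtain A where A: "A \<in> set (parts J)" "f \<in> set A" by blast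
  have "A \<noteq> []" using A by auto
  then have "hd A \<in> set A" by (rule hd_in_set)
  with A representative_part show ?thesis by (intro part)
next
  case False
  with representative_no_part show ?thesis by (intro no_part) blast+
qed

lemma representative_in: "f \<in> facility_set J \<Longrightarrow> representative J f \<in> facility_set J"
  using J by (cases f rule: representative_cases) (auto simp: pcm_instance_def)

lemma val_representative: "val J (representative J f) = val J f"
proof (cases f rule: representative_cases)
  case (part A)
  then show ?thesis using J unfolding pcm_instance_def by metis
qed simp

lemma representative_idem: "representative J (representative J f) = representative J f"
  by (cases f rule: representative_cases) (auto simp: representative_part)

text \<open>The representative of a facility in some part lies in that part, so it differs from
  every facility outside all parts; and the latter are their own representatives.\<close>

lemma common_part:
  assumes "representative J f = representative J g" "f \<noteq> g"
  obtains A where "A \<in> set (parts J)" "f \<in> set A" "g \<in> set A"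
proof (cases f rule: representative_cases)
  case f: (part A)
  show ?thesis
  proof (cases g rule: representative_cases)
    case (part B)
    with f assms(1) have "A = B" by (metis part_unique)
    with f part show ?thesis using that by blast
  next
    case no_part
    with f assms(1) show ?thesis by metis
  qed
next
  case f: no_part
  show ?thesis
  proof (cases g rule: representative_cases)
    case (part B)
    with f assms(1) show ?thesis by metis
  next
    case no_part
    with f assms show ?thesis by simp
  qed
qed

section \<open>Names of clients and validity of the supplier instance\<close>

lemma facility_less_offset:
  assumes "f \<in> facility_set J"
  shows "f < offset J"
proof -
  \<comment> \<open>A total of bit lengths dominates each of them, and unlike a maximum it is
    computed by mere concatenation.\<close>
  have "length (bits f) \<le> length (concat (map bits (facilities J)))"
    using assms by (auto simp: length_concat intro!: member_le_sum_list)
  then have "(2::nat) ^ length (bits f) \<le> offset J"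
    unfolding offset_def by (intro power_increasing) auto
  with less_power_length_bits[of f] show ?thesis by linarith
qed

lemma distinct_facilities: "distinct (facilities J)"
  using J by (simp add: pcm_instance_def down_closed_system_def)

lemma offset_pos: "offset J > 0"
  by (simp add: offset_def)

lemma inj_client_name: "inj (\<lambda>k. offset J * 2 ^ k)"
  using offset_pos by (auto simp: inj_on_def)

lemma distinct_clients: "distinct (map fst (tagged_clients J))"
  using inj_client_name
  by (auto simp: tagged_clients_def distinct_map o_def intro: inj_on_subset)

text \<open>Makes lookups by \<open>tag\<close> return the tag listed with the point. Facilities and
  clients cannot clash because client names are at least the offset.\<close>

lemma distinct_tagged_points: "distinct (map fst (tagged_points J))"
proof -
  have "offset J * 2 ^ k \<notin> facility_set J" for k
  proof
    assume "offset J * 2 ^ k \<in> facility_set J"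
    then have "offset J * 2 ^ k < offset J * 1" using facility_less_offset by simp
    then show False unfolding mult_less_cancel1 by simp
  qed
  then show ?thesis
    using distinct_clients distinct_facilities
    by (auto simp: tagged_points_def tagged_clients_def o_def)
qed

lemma tag_eq: "(u, t) \<in> set (tagged_points J) \<Longrightarrow> tag J u = t"
  using map_of_is_SomeI[OF distinct_tagged_points] by (simp add: tag_def)

lemma tag_facility: "f \<in> facility_set J \<Longrightarrow> tag J f = representative J f"
  by (rule tag_eq) (simp add: tagged_points_def)

lemma tag_client: "k < length (tags J) \<Longrightarrow> tag J (offset J * 2 ^ k) = tags J ! k"
  by (rule tag_eq) (auto simp: tagged_points_def tagged_clients_def)

lemma client_set_eq:
  "client_set (supplier_of J m) = (\<lambda>k. offset J * 2 ^ k) ` {..<length (tags J)}"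
  by (auto simp: tagged_clients_def)

lemma supplier_instance_supplier_of:
  assumes "m \<le> length (tags J)"
  shows "supplier_instance R (supplier_of J m)"
proof -
  have "card (client_set (supplier_of J m)) = length (tags J)"
    unfolding client_set_eq using inj_client_name by (subst card_image) (auto intro: inj_on_subset)
  \<comment> \<open>Having equal tags is an equivalence relation, so the distances 0, 1 and infinity
    obey the triangle inequality on any set.\<close>
  moreover have "metric_on X (pt_dist (supplier_of J m))" for X
    unfolding metric_on_def pt_dist_supplier_of by auto
  ultimately show ?thesis
    using J assms distinct_clients
    by (auto simp: supplier_instance_def pcm_instance_def down_closed_system_def split: if_splits)
qed

section \<open>Coverage, cost and optimum of the supplier instance\<close>

lemma card_clients_with_tag:
  "card {u \<in> client_set (supplier_of J m). tag J u \<in> X} =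
    (\<Sum>f\<in>facility_set J. if representative J f = f \<and> f \<in> X then val J f else 0)"
proof -
  \<comment> \<open>Names determine positions in \<open>tags\<close>; counting clients becomes
    counting list entries, and these come in replicated blocks, one for each representative.\<close>
  have "{u \<in> client_set (supplier_of J m). tag J u \<in> X} =
      (\<lambda>k. offset J * 2 ^ k) ` {k. k < length (tags J) \<and> tags J ! k \<in> X}"
    unfolding client_set_eq using tag_client by auto
  also have "card \<dots> = card {k. k < length (tags J) \<and> tags J ! k \<in> X}"
    using inj_client_name by (intro card_image) (auto intro: inj_on_subset)
  also have "\<dots> = length (filter (\<lambda>t. t \<in> X) (tags J))"
    by (simp add: length_filter_conv_card)
  also have "\<dots> = (\<Sum>f\<leftarrow>facilities J. if representative J f = f \<and> f \<in> X then val J f else 0)"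
  proof -
    have "length (filter P (concat (map (\<lambda>f. replicate (n f) f) fs))) = (\<Sum>f\<leftarrow>fs. if P f then n f else 0)"
      for P :: "nat \<Rightarrow> bool" and n fs
      by (induction fs) simp_all
    then show ?thesis
      unfolding tags_def by (auto intro!: arg_cong[where f = sum_list])
  qed
  also have "\<dots> = (\<Sum>f\<in>facility_set J. if representative J f = f \<and> f \<in> X then val J f else 0)"
    by (rule sum_list_distinct_conv_sum_set[OF distinct_facilities])
  finally show ?thesis .
qed

text \<open>The bridge between the two objectives: the clients at finite distance from
  \<open>S\<close> are as many as the total value of the groups that it hits.\<close>

lemma card_covered_clients:
  assumes "S \<subseteq> facility_set J"
  shows "card {u \<in> client_set (supplier_of J m). tag J u \<in> representative J ` S} =
    (\<Sum>r\<in>representative J ` S. val J r)"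
  unfolding card_clients_with_tag
proof (rule sum.mono_neutral_cong_right)
  show "representative J ` S \<subseteq> facility_set J"
    using assms representative_in by auto
qed (auto simp: representative_idem)

lemma covered_iff:
  assumes "set xs \<subseteq> facility_set J" "set ys \<subseteq> client_set (supplier_of J m)"
  shows "covered J xs ys \<longleftrightarrow> (\<forall>u\<in>set ys. tag J u \<in> representative J ` set xs)"
proof -
  have "(\<exists>p\<in>set (tagged_points J). \<exists>q\<in>set (tagged_points J). fst p = u \<and> fst q \<in> set xs \<and> snd p = snd q) \<longleftrightarrow>
      tag J u \<in> representative J ` set xs" if "u \<in> set ys" for u
  proof
    assume "\<exists>p\<in>set (tagged_points J). \<exists>q\<in>set (tagged_points J). fst p = u \<and> fst q \<in> set xs \<and> snd p = snd q"
    then obtain f t where "(u, t) \<in> set (tagged_points J)" "(f, t) \<in> set (tagged_points J)" "f \<in> set xs"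
      by auto
    then show "tag J u \<in> representative J ` set xs"
      using tag_eq tag_facility assms(1) by (metis image_eqI subsetD)
  next
    assume "tag J u \<in> representative J ` set xs"
    then obtain f where f: "f \<in> set xs" "tag J u = representative J f" by auto
    then have "(f, tag J u) \<in> set (tagged_points J)"
      using assms(1) by (auto simp: tagged_points_def)
    moreover have "u \<in> client_set (supplier_of J m)" using assms(2) that by blast
    then have "u \<in> fst ` set (tagged_points J)"
      by (auto simp: tagged_points_def)
    then obtain t where "(u, t) \<in> set (tagged_points J)" by auto
    then have "(u, tag J u) \<in> set (tagged_points J)"
      using tag_eq by metis
    ultimately show "\<exists>p\<in>set (tagged_points J). \<exists>q\<in>set (tagged_points J). fst p = u \<and> fst q \<in> set xs \<and> snd p = snd q"
      using f(1) by (intro bexI[of _ "(u, tag J u)"] bexI[of _ "(f, tag J u)"]) simp_all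
  qed
  then show ?thesis by (simp add: covered_def)
qed

text \<open>An infimum below infinity has a member below infinity, which also rules out an empty
  \<open>S\<close>; and a finite distance forces equal tags.\<close>

lemma finite_cost_imp_covered:
  assumes "supplier_cost (supplier_of J m) S T < \<infinity>" "S \<subseteq> facility_set J" "u \<in> T"
  shows "tag J u \<in> representative J ` S"
proof -
  have "dist_to_set (supplier_of J m) u S < \<infinity>"
    using assms(1) SUP_upper[OF assms(3), of "\<lambda>u. dist_to_set (supplier_of J m) u S"]
    unfolding supplier_cost_def by (rule le_less_trans[rotated])
  then obtain f where f: "f \<in> S" "pt_dist (supplier_of J m) u f < \<infinity>"
    unfolding dist_to_set_def by (auto simp: INF_less_iff)
  then have "tag J u = tag J f"
    by (auto simp: pt_dist_supplier_of split: if_splits)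
  with f(1) assms(2) tag_facility show ?thesis by auto
qed

lemma opt_le_1:
  assumes "S \<in> sets_of R (family J)" "m \<le> (\<Sum>r\<in>representative J ` S. val J r)"
  shows "supplier_opt R (supplier_of J m) \<le> 1"
proof -
  let ?I = "supplier_of J m"
  define T where "T = {u \<in> client_set ?I. tag J u \<in> representative J ` S}"
  have S: "S \<subseteq> facility_set J"
    using assms(1) J by (auto simp: pcm_instance_def down_closed_system_def)
  have "card T \<ge> m"
    unfolding T_def card_covered_clients[OF S] by (rule assms(2))
  then have "supplier_feasible R ?I S T"
    using assms(1) by (auto simp: supplier_feasible_def T_def)
  then have "supplier_opt R ?I \<le> supplier_cost ?I S T"
    unfolding supplier_opt_def by (intro INF_lower2[of "(S, T)"]) auto
  also have "\<dots> \<le> 1"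
    unfolding supplier_cost_def
  proof (rule SUP_least)
    fix u assume "u \<in> T"
    then obtain f where "f \<in> S" "tag J u = representative J f"
      by (auto simp: T_def)
    moreover from this S have "tag J u = tag J f" using tag_facility by auto
    ultimately show "dist_to_set ?I u S \<le> 1"
      unfolding dist_to_set_def by (intro INF_lower2[of f]) (auto simp: pt_dist_supplier_of)
  qed
  finally show ?thesis .
qed

section \<open>Pruning to one facility per group\<close>

lemma set_prune_subset: "set (prune J xs) \<subseteq> set xs"
  using set_take_subset[of 1] by (fastforce simp: prune_def)

lemma distinct_prune: "distinct (prune J xs)"
proof -
  let ?g = "\<lambda>r. take 1 (filter (\<lambda>f. representative J f = r) xs)"
  have "distinct (concat (map ?g rs))" if "distinct rs" for rs
    using that
  proof (induction rs)
    case (Cons r rs)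
    have "distinct (take 1 ys)" for ys :: "nat list"
      by (cases ys) auto
    moreover have "set (?g r) \<inter> set (concat (map ?g rs)) = {}"
    proof (rule equals0I)
      fix f assume f: "f \<in> set (?g r) \<inter> set (concat (map ?g rs))"
      then obtain r' where r': "r' \<in> set rs" "f \<in> set (?g r')"
        unfolding set_concat set_map by blast
      from f have "f \<in> set (?g r)" by blast
      from in_set_takeD[OF this] in_set_takeD[OF r'(2)] have "r = r'" by simp
      with r' Cons.prems show False by simp
    qed
    moreover have "distinct (concat (map ?g rs))"
      using Cons by simp
    ultimately show ?case
      unfolding list.map concat.simps distinct_append by blast
  qed simp
  then show ?thesis
    unfolding prune_def using distinct_facilities by blast
qed

lemma prune_unique:
  assumes "f \<in> set (prune J xs)" "g \<in> set (prune J xs)" "representative J f = representative J g"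
  shows "f = g"
proof -
  have "f = hd (filter (\<lambda>g. representative J g = representative J f) xs)" if "f \<in> set (prune J xs)" for f
  proof -
    from that obtain r where "f \<in> set (take 1 (filter (\<lambda>f. representative J f = r) xs))"
      by (auto simp: prune_def)
    moreover from in_set_takeD[OF this] have "representative J f = r" by simp
    ultimately show ?thesis
      unfolding set_take_1 by (auto split: if_splits)
  qed
  with assms show ?thesis by metis
qed

text \<open>No group that was hit gets lost: the representative of a facility is itself a facility,
  hence one of the \<open>r\<close> over which \<open>prune\<close> runs.\<close>

lemma representative_image_prune:
  assumes "set xs \<subseteq> facility_set J"
  shows "representative J ` set (prune J xs) = representative J ` set xs"
proof
  show "representative J ` set xs \<subseteq> representative J ` set (prune J xs)"
  proof
    fix r assume "r \<in> representative J ` set xs"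
    then obtain f where f: "f \<in> set xs" "representative J f = r" by auto
    let ?ys = "filter (\<lambda>f. representative J f = r) xs"
    from f have "?ys \<noteq> []" by (auto simp: filter_empty_conv)
    then have "hd ?ys \<in> set ?ys" "hd ?ys \<in> set (take 1 ?ys)"
      unfolding set_take_1 by (simp_all only: hd_in_set if_False simp_thms insertI1)
    moreover have "r \<in> facility_set J"
      using f assms representative_in by auto
    ultimately have "hd ?ys \<in> set (prune J xs)" "representative J (hd ?ys) = r"
      by (auto simp: prune_def)
    then show "r \<in> representative J ` set (prune J xs)"
      by (metis imageI)
  qed
qed (use set_prune_subset in blast)

text \<open>Translates between the value counted by groups, which the supplier instance sees, and
  the objective of the maximization problem.\<close>

lemma sum_val_representatives:
  assumes "inj_on (representative J) S"
  shows "(\<Sum>r\<in>representative J ` S. val J r) = (\<Sum>f\<in>S. val J f)"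
  using assms by (simp add: sum.reindex val_representative)

lemma inj_on_representative:
  assumes "pcm_feasible R J S" "finite S"
  shows "inj_on (representative J) S"
proof (rule inj_onI, rule ccontr)
  fix f g assume fg: "f \<in> S" "g \<in> S" "representative J f = representative J g" "f \<noteq> g"
  then obtain A where A: "A \<in> set (parts J)" "f \<in> set A" "g \<in> set A"
    by (auto elim: common_part)
  have "card {f, g} \<le> card (S \<inter> set A)"
    using fg A by (intro card_mono) auto
  then show False
    using assms(1) A(1) fg(4) by (auto simp: pcm_feasible_def)
qed

lemma pcm_feasible_prune:
  assumes "set xs \<in> sets_of R (family J)"
  shows "pcm_feasible R J (set (prune J xs))"
proof -
  have "card (set (prune J xs) \<inter> set A) \<le> 1" if "A \<in> set (parts J)" for A
  proof (rule card_le_Suc0_iff_eq[THEN iffD2, folded One_nat_def])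
    show "\<forall>f\<in>set (prune J xs) \<inter> set A. \<forall>g\<in>set (prune J xs) \<inter> set A. f = g"
      using prune_unique representative_part[OF that] by (metis IntD1 IntD2)
  qed simp
  moreover have "\<forall>S\<in>sets_of R (family J). \<forall>S'\<subseteq>S. S' \<in> sets_of R (family J)"
    using J by (simp add: pcm_instance_def down_closed_system_def)
  then have "set (prune J xs) \<in> sets_of R (family J)"
    using assms set_prune_subset by blast
  ultimately show ?thesis by (simp add: pcm_feasible_def)
qed

lemma pcm_optimal_prune_best:
  fixes \<alpha> :: real
  assumes out: "\<And>m. m \<le> length (tags J) \<Longrightarrow>
    distinct (snd (out m)) \<and> supplier_feasible R (supplier_of J m) (set (fst (out m))) (set (snd (out m))) \<and>
    supplier_cost (supplier_of J m) (set (fst (out m))) (set (snd (out m))) \<le> ennreal \<alpha> * supplier_opt R (supplier_of J m)"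
  shows "pcm_optimal R J (set (prune J (best J out (length (tags J)))))"
proof -
  let ?cov = "\<lambda>S. \<Sum>r\<in>representative J ` S. val J r"
  have sub: "S \<subseteq> facility_set J" if "S \<in> sets_of R (family J)" for S
    using that J by (auto simp: pcm_instance_def down_closed_system_def)
  \<comment> \<open>Loop invariant: every threshold \<open>v\<close> up to \<open>k\<close> that
    some member of the family reaches is reached by the current best. Comparing thresholds instead
    of values lets \<open>k\<close> cut off what has not been tried yet.\<close>
  have "k \<le> length (tags J) \<Longrightarrow> set (best J out k) \<in> sets_of R (family J) \<and>
      (\<forall>S\<in>sets_of R (family J). \<forall>v\<le>k. v \<le> ?cov S \<longrightarrow> v \<le> ?cov (set (best J out k)))" for k
  proof (induction k)
    case 0
    from J have "{} \<in> sets_of R (family J)"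
      unfolding pcm_instance_def down_closed_system_def by (metis all_not_in_conv empty_subsetI)
    then show ?case by simp
  next
    case (Suc k)
    obtain xs ys where o: "out (Suc k) = (xs, ys)" by fastforce
    let ?I = "supplier_of J (Suc k)"
    from out[OF Suc.prems] o have
      xs: "set xs \<in> sets_of R (family J)" and ys: "set ys \<subseteq> client_set ?I" "Suc k \<le> card (set ys)"
      and cost: "supplier_cost ?I (set xs) (set ys) \<le> ennreal \<alpha> * supplier_opt R ?I"
      by (auto simp: supplier_feasible_def)
    note cov = covered_iff[OF sub[OF xs] ys(1)]
    show ?case
    proof (cases "covered J xs ys")
      case True
      then have "set ys \<subseteq> {u \<in> client_set ?I. tag J u \<in> representative J ` set xs}"
        using cov ys(1) by blast
      then have "card (set ys) \<le> card {u \<in> client_set ?I. tag J u \<in> representative J ` set xs}"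
        by (intro card_mono) auto
      also have "\<dots> = ?cov (set xs)"
        by (rule card_covered_clients[OF sub[OF xs]])
      finally have "Suc k \<le> ?cov (set xs)"
        using ys(2) by linarith
      with True o xs show ?thesis by auto
    next
      case False
      have "\<not> Suc k \<le> ?cov S" if "S \<in> sets_of R (family J)" for S
      proof
        assume "Suc k \<le> ?cov S"
        have "supplier_opt R ?I \<le> 1"
          by (rule opt_le_1) fact+
        \<comment> \<open>The approximation guarantee is used only here, for a demand that some
          member of the family meets at cost at most 1.\<close>
        then have "ennreal \<alpha> * supplier_opt R ?I \<le> ennreal \<alpha> * 1"
          by (rule mult_left_mono) simp
        with cost have "supplier_cost ?I (set xs) (set ys) \<le> ennreal \<alpha>" by simp
        also have "\<dots> < \<infinity>" by simp
        finally have "supplier_cost ?I (set xs) (set ys) < \<infinity>" .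
        with False cov finite_cost_imp_covered[OF _ sub[OF xs]] show False by blast
      qed
      with False o Suc show ?thesis
        by (auto simp: le_Suc_eq)
    qed
  qed
  from this[OF order_refl] have best: "set (best J out (length (tags J))) \<in> sets_of R (family J)"
    "\<And>S v. S \<in> sets_of R (family J) \<Longrightarrow> v \<le> length (tags J) \<Longrightarrow> v \<le> ?cov S \<Longrightarrow>
      v \<le> ?cov (set (best J out (length (tags J))))" by auto
  let ?P = "set (prune J (best J out (length (tags J))))"
  have feasible: "pcm_feasible R J ?P"
    by (rule pcm_feasible_prune[OF best(1)])
  have "(\<Sum>f\<in>S. val J f) \<le> (\<Sum>f\<in>?P. val J f)" if S: "pcm_feasible R J S" for S
  proof -
    from S have S': "S \<in> sets_of R (family J)" by (simp add: pcm_feasible_def)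
    have fin: "finite S" using finite_subset[OF sub[OF S']] by simp
    \<comment> \<open>The client set is the same for every demand, so 0 is as good as any. The group
      value of \<open>S\<close> is at most the number of clients and thus itself among the
      thresholds of the invariant.\<close>
    have "?cov S = card {u \<in> client_set (supplier_of J 0). tag J u \<in> representative J ` S}"
      by (simp only: card_covered_clients[OF sub[OF S']])
    also have "\<dots> \<le> card (client_set (supplier_of J 0))"
      by (intro card_mono) auto
    also have "\<dots> \<le> length (tags J)"
      unfolding client_set_eq using card_image_le[of "{..<length (tags J)}"] by simp
    finally have "?cov S \<le> ?cov (set (best J out (length (tags J))))"
      by (intro best(2)[OF S']) simp_all
    \<comment> \<open>Both sets meet each group at most once, and pruning has kept the groups of the
      best answer.\<close>
    then show ?thesis
      using sum_val_representatives[OF inj_on_representative[OF S fin]]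
        sum_val_representatives[OF inj_on_representative[OF feasible]]
        representative_image_prune[OF sub[OF best(1)]] by simp
  qed
  with feasible show ?thesis
    by (simp add: pcm_optimal_def)
qed

end

subsection \<open>Running time\<close>

abbreviation enc_nat_pair :: "nat \<times> nat \<Rightarrow> tree" where
  "enc_nat_pair p \<equiv> Node (enc_nat (fst p)) (enc_nat (snd p))"

context
  fixes R :: "'r representation" and D :: "'i set" and \<kappa> :: "'i \<Rightarrow> resources"
    and e :: "'i \<Rightarrow> tree" and J :: "'i \<Rightarrow> 'r pcm"
  assumes enc: "polytime D \<kappa> e (\<lambda>i. enc_pcm R (J i))"
begin

lemma polytime_facilities: "polytime D \<kappa> e (\<lambda>i. enc_list enc_nat (facilities (J i)))"
  and polytime_parts: "polytime D \<kappa> e (\<lambda>i. enc_list (enc_list enc_nat) (parts (J i)))"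
  and polytime_values: "polytime D \<kappa> e (\<lambda>i. enc_list (\<lambda>f. enc_nat (val (J i) f)) (facilities (J i)))"
  and polytime_description: "polytime D \<kappa> e (\<lambda>i. description R (family (J i)))"
  using polytime_left[OF enc] polytime_left[OF polytime_right[OF enc]]
    polytime_left[OF polytime_right[OF polytime_right[OF enc]]]
    polytime_right[OF polytime_right[OF polytime_right[OF enc]]]
  by (simp_all add: enc_pcm_def)

lemma polytime_representative:
  assumes f: "polytime D \<kappa> e (\<lambda>i. enc_nat (f i))"
  shows "polytime D \<kappa> e (\<lambda>i. enc_nat (representative (J i) (f i)))"
proof -
  let ?As = "\<lambda>i. filter (\<lambda>A. f i \<in> set A) (parts (J i))"
  have As: "polytime D \<kappa> e (\<lambda>i. enc_list (enc_list enc_nat) (?As i))"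
  proof (rule polytime_filter[OF polytime_parts])
    fix e'
    let ?D = "SIGMA i:D. set (parts (J i))" and ?\<kappa> = "\<lambda>j. \<kappa> (fst j)"
    assume A: "polytime ?D ?\<kappa> e' (\<lambda>j. enc_list enc_nat (snd j))"
      and up: "\<And>g. polytime D \<kappa> e g \<Longrightarrow> polytime ?D ?\<kappa> e' (\<lambda>j. g (fst j))"
    show "polytime ?D ?\<kappa> e' (\<lambda>j. enc_bool (f (fst j) \<in> set (snd j)))"
      by (rule polytime_member[OF up[OF f] A])
  qed
  \<comment> \<open>The inner \<open>left\<close> yields the first part containing
    \<open>f i\<close>, the outer one its head; the part is nonempty as it contains
    \<open>f i\<close>.\<close>
  have "polytime D \<kappa> e (\<lambda>i. if ?As i = [] then enc_nat (f i) else left (left (enc_list (enc_list enc_nat) (?As i))))"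
    by (rule polytime_if[OF polytime_null[OF As]])
      (rule polytime_subset[OF f] polytime_subset[OF polytime_left[OF polytime_left[OF As]]], blast)+
  then show ?thesis
  proof (rule polytime_cong)
    fix i assume "i \<in> D"
    show "(if ?As i = [] then enc_nat (f i) else left (left (enc_list (enc_list enc_nat) (?As i)))) =
        enc_nat (representative (J i) (f i))"
    proof (cases "?As i")
      case (Cons A As)
      then have "A \<in> set (?As i)" by simp
      then have "A \<noteq> []" by auto
      with Cons show ?thesis by (simp add: representative_def left_enc_list)
    qed (simp add: representative_def)
  qed
qed

end

text \<open>The polynomial bound on \<open>val\<close> enters here, through
  \<open>polytime_replicate\<close>.\<close>

lemma polytime_tags:
  assumes enc: "polytime D \<kappa> e (\<lambda>i. enc_pcm R (J i))"
    and J: "\<And>i. i \<in> D \<Longrightarrow> pcm_instance R b (J i)"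
  shows "polytime D \<kappa> e (\<lambda>i. enc_list enc_nat (tags (J i)))"
proof -
  \<comment> \<open>Values are presented as a list parallel to the facilities; zipping replaces the
    lookup of a value.\<close>
  let ?ps = "\<lambda>i. zip (facilities (J i)) (map (val (J i)) (facilities (J i)))"
  have ps: "polytime D \<kappa> e (\<lambda>i. enc_list enc_nat_pair (?ps i))"
    using polytime_values[OF enc]
    by (intro polytime_zip polytime_facilities[OF enc]) (simp_all add: enc_list_map)
  let ?n = "\<lambda>i p. if representative (J i) (fst p) = fst p then snd p else 0"
  have "polytime D \<kappa> e (\<lambda>i. enc_list enc_nat (concat (map (\<lambda>p. replicate (?n i p) (fst p)) (?ps i))))"
  proof (rule polytime_concat, rule polytime_map[OF ps])
    fix e'
    let ?D = "SIGMA i:D. set (?ps i)" and ?\<kappa> = "\<lambda>j. \<kappa> (fst j)"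
    assume p: "polytime ?D ?\<kappa> e' (\<lambda>j. enc_nat_pair (snd j))"
      and up: "\<And>g. polytime D \<kappa> e g \<Longrightarrow> polytime ?D ?\<kappa> e' (\<lambda>j. g (fst j))"
    note p1 = polytime_fst[OF p] and p2 = polytime_snd[OF p]
    have rep: "polytime ?D ?\<kappa> e' (\<lambda>j. enc_nat (representative (J (fst j)) (fst (snd j))))"
      by (rule polytime_representative[OF up[OF enc] p1])
    have "polytime ?D ?\<kappa> e' (\<lambda>j. if representative (J (fst j)) (fst (snd j)) = fst (snd j)
        then enc_nat (snd (snd j)) else enc_nat 0)"
      by (rule polytime_if[OF polytime_nat_eq[OF rep p1]])
        (rule polytime_subset[OF p2] polytime_subset[OF polytime_const'[OF p2]], blast)+
    then have n: "polytime ?D ?\<kappa> e' (\<lambda>j. enc_nat (?n (fst j) (snd j)))"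
      by (rule polytime_cong) simp
    have "poly_bounded ?D ?\<kappa> (\<lambda>j. poly b (length (facilities (J (fst j)))))"
      by (intro poly_bounded_poly poly_bounded_reindex[OF polytime_length[OF polytime_facilities[OF enc]]]) auto
    then have "poly_bounded ?D ?\<kappa> (\<lambda>j. ?n (fst j) (snd j))"
    proof (rule poly_bounded_mono)
      fix j assume "j \<in> ?D"
      then obtain i f where j: "j = (i, (f, val (J i) f))" "i \<in> D" "f \<in> facility_set (J i)"
        by (auto simp: zip_map2 zip_same_conv_map)
      then have "val (J i) f \<le> poly b (card (facility_set (J i)))"
        using J by (auto simp: pcm_instance_def)
      also have "\<dots> \<le> poly b (length (facilities (J i)))"
        by (intro poly_nat_mono card_length)
      finally show "?n (fst j) (snd j) \<le> poly b (length (facilities (J (fst j))))"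
        using j by simp
    qed
    then show "polytime ?D ?\<kappa> e' (\<lambda>j. enc_list enc_nat (replicate (?n (fst j) (snd j)) (fst (snd j))))"
      by (rule polytime_replicate[where ex = enc_nat, OF n p1])
  qed
  then show ?thesis
    by (simp add: tags_def zip_map2 zip_same_conv_map o_def cong: if_cong)
qed

text \<open>A power of two is a block of zeros topped by a one: all bits of all facilities are
  cleared and a one bit is appended.\<close>

lemma polytime_offset:
  assumes enc: "polytime D \<kappa> e (\<lambda>i. enc_pcm R (J i))"
  shows "polytime D \<kappa> e (\<lambda>i. enc_nat (offset (J i)))"
proof -
  have "polytime D \<kappa> e (\<lambda>i. enc_list (enc_list enc_bool) (map bits (facilities (J i))))"
    using polytime_facilities[OF enc] by (simp add: enc_list_map enc_nat_bits[abs_def])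
  note bs = polytime_concat[OF this]
  have "polytime D \<kappa> e (\<lambda>i. enc_list enc_bool (map (\<lambda>_. False) (concat (map bits (facilities (J i))))))"
    by (rule polytime_map[OF bs]) (rule polytime_const')
  moreover have "polytime D \<kappa> e (\<lambda>i. enc_list enc_bool [True])"
    by (rule polytime_const'[OF bs])
  ultimately have "polytime D \<kappa> e (\<lambda>i. enc_list enc_bool
      (map (\<lambda>_. False) (concat (map bits (facilities (J i)))) @ [True]))"
    by (rule polytime_append)
  then show ?thesis
    by (simp add: enc_nat_bits offset_def bits_power_of_two map_replicate_const)
qed

lemma polytime_tagged_clients:
  assumes enc: "polytime D \<kappa> e (\<lambda>i. enc_pcm R (J i))"
    and J: "\<And>i. i \<in> D \<Longrightarrow> pcm_instance R b (J i)"
  shows "polytime D \<kappa> e (\<lambda>i. enc_list enc_nat_pair (tagged_clients (J i)))"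
proof -
  have tags: "polytime D \<kappa> e (\<lambda>i. enc_list enc_nat (tags (J i)))"
    by (rule polytime_tags[OF assms])
  have "polytime D \<kappa> e (\<lambda>i. enc_list enc_nat_pair
      (zip (map (\<lambda>k. offset (J i) * 2 ^ k) [0..<length (tags (J i))]) (tags (J i))))"
    by (intro polytime_zip polytime_doublings[OF tags] polytime_offset[OF enc] tags) (simp_all add: offset_def)
  moreover have "zip (map f [0..<length xs]) xs = map (\<lambda>k. (f k, xs ! k)) [0..<length xs]" for f :: "nat \<Rightarrow> nat" and xs :: "nat list"
    by (rule nth_equalityI) simp_all
  ultimately show ?thesis
    by (simp add: tagged_clients_def)
qed

lemma polytime_tagged_points:
  assumes enc: "polytime D \<kappa> e (\<lambda>i. enc_pcm R (J i))"
    and J: "\<And>i. i \<in> D \<Longrightarrow> pcm_instance R b (J i)"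
  shows "polytime D \<kappa> e (\<lambda>i. enc_list enc_nat_pair (tagged_points (J i)))"
proof -
  have "polytime D \<kappa> e (\<lambda>i. enc_list enc_nat_pair (map (\<lambda>f. (f, representative (J i) f)) (facilities (J i))))"
  proof (rule polytime_map[OF polytime_facilities[OF enc]])
    fix e'
    let ?D = "SIGMA i:D. facility_set (J i)" and ?\<kappa> = "\<lambda>j. \<kappa> (fst j)"
    assume f: "polytime ?D ?\<kappa> e' (\<lambda>j. enc_nat (snd j))"
      and up: "\<And>g. polytime D \<kappa> e g \<Longrightarrow> polytime ?D ?\<kappa> e' (\<lambda>j. g (fst j))"
    show "polytime ?D ?\<kappa> e' (\<lambda>j. enc_nat_pair (snd j, representative (J (fst j)) (snd j)))"
      using polytime_pair[OF f polytime_representative[OF up[OF enc] f]] by simp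
  qed
  from polytime_append[OF this polytime_tagged_clients[OF assms]] show ?thesis
    by (simp add: tagged_points_def)
qed

lemma enc_list_cong: "(\<And>x. x \<in> set xs \<Longrightarrow> f x = g x) \<Longrightarrow> enc_list f xs = enc_list g xs"
  by (induction xs) simp_all

lemma polytime_enc_supplier:
  assumes enc: "polytime D \<kappa> e (\<lambda>i. enc_pcm R (J i))"
    and J: "\<And>i. i \<in> D \<Longrightarrow> pcm_instance R b (J i)"
    and m: "polytime D \<kappa> e (\<lambda>i. enc_nat (m i))"
  shows "polytime D \<kappa> e (\<lambda>i. enc_supplier R (supplier_of (J i) (m i)))"
proof -
  note pts = polytime_tagged_points[OF enc J]
  let ?pts = "\<lambda>i. tagged_points (J i)"
  \<comment> \<open>Works on points with attached tags, so the program needs no evaluation of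
    \<open>tag\<close>; \<open>tag_eq\<close> later identifies the result with
    \<open>distance\<close>.\<close>
  define dst :: "nat \<times> nat \<Rightarrow> nat \<times> nat \<Rightarrow> tree" where
    "dst p q = (if fst p = fst q then enc_dist (Some 0)
      else if snd p = snd q then enc_dist (Some 1) else enc_dist None)" for p q
  have matrix: "polytime D \<kappa> e (\<lambda>i. enc_list (\<lambda>t. t)
      (map (\<lambda>p. enc_list (\<lambda>t. t) (map (\<lambda>q. dst p q) (?pts i))) (?pts i)))"
  proof (rule polytime_map[OF pts])
    fix e'
    let ?D = "SIGMA i:D. set (?pts i)" and ?\<kappa> = "\<lambda>j. \<kappa> (fst j)"
    assume p: "polytime ?D ?\<kappa> e' (\<lambda>j. enc_nat_pair (snd j))"
      and up: "\<And>g. polytime D \<kappa> e g \<Longrightarrow> polytime ?D ?\<kappa> e' (\<lambda>j. g (fst j))"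
    show "polytime ?D ?\<kappa> e' (\<lambda>j. enc_list (\<lambda>t. t) (map (\<lambda>q. dst (snd j) q) (?pts (fst j))))"
    proof (rule polytime_map[OF up[OF pts]])
      fix e''
      let ?E = "SIGMA j:?D. set (?pts (fst j))" and ?\<kappa>' = "\<lambda>l. \<kappa> (fst (fst l))"
      assume q: "polytime ?E ?\<kappa>' e'' (\<lambda>l. enc_nat_pair (snd l))"
        and up': "\<And>g. polytime ?D ?\<kappa> e' g \<Longrightarrow> polytime ?E ?\<kappa>' e'' (\<lambda>l. g (fst l))"
      note p' = up'[OF p]
      have inner: "polytime ?E ?\<kappa>' e''
          (\<lambda>l. if snd (snd (fst l)) = snd (snd l) then enc_dist (Some 1) else enc_dist None)"
        by (rule polytime_if[OF polytime_nat_eq[OF polytime_snd[OF p'] polytime_snd[OF q]]])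
          (rule polytime_subset[OF polytime_const'[OF q]], blast)+
      show "polytime ?E ?\<kappa>' e'' (\<lambda>l. dst (snd (fst l)) (snd l))"
        unfolding dst_def
        by (rule polytime_if[OF polytime_nat_eq[OF polytime_fst[OF p'] polytime_fst[OF q]]])
          (rule polytime_subset[OF polytime_const'[OF q]], blast, rule polytime_subset[OF inner], blast)
    qed
  qed
  have tc: "polytime D \<kappa> e (\<lambda>i. enc_list enc_nat_pair (tagged_clients (J i)))"
    by (rule polytime_tagged_clients[OF enc J])
  have "polytime D \<kappa> e (\<lambda>i. enc_list enc_nat (map fst (tagged_clients (J i))))"
    by (rule polytime_map[OF tc]) (rule polytime_fst)
  from polytime_pair[OF polytime_facilities[OF enc] polytime_pair[OF this
        polytime_pair[OF matrix polytime_pair[OF m polytime_description[OF enc]]]]]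
  show ?thesis
  proof (rule polytime_cong)
    fix i assume "i \<in> D"
    let ?I = "supplier_of (J i) (m i)"
    have xs: "facilities ?I @ clients ?I = map fst (?pts i)"
      by (simp add: tagged_points_def o_def)
    have "dst p q = enc_dist (distance ?I (fst p) (fst q))" if "p \<in> set (?pts i)" "q \<in> set (?pts i)" for p q
      using that tag_eq[OF J[OF \<open>i \<in> D\<close>], of "fst p" "snd p"] tag_eq[OF J[OF \<open>i \<in> D\<close>], of "fst q" "snd q"]
      by (auto simp: dst_def)
    then show "Node (enc_list enc_nat (facilities (J i))) (Node (enc_list enc_nat (map fst (tagged_clients (J i))))
        (Node (enc_list (\<lambda>t. t) (map (\<lambda>p. enc_list (\<lambda>t. t) (map (\<lambda>q. dst p q) (?pts i))) (?pts i)))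
        (Node (enc_nat (m i)) (description R (family (J i)))))) = enc_supplier R ?I"
      unfolding enc_supplier_def Let_def xs enc_list_map
      by (auto simp: enc_list_map intro!: enc_list_cong)
  qed
qed

section \<open>Evaluating the answers of the approximation algorithm\<close>

lemma polytime_covered:
  assumes enc: "polytime D \<kappa> e (\<lambda>i. enc_pcm R (J i))"
    and J: "\<And>i. i \<in> D \<Longrightarrow> pcm_instance R b (J i)"
    and xs: "polytime D \<kappa> e (\<lambda>i. enc_list enc_nat (xs i))"
    and ys: "polytime D \<kappa> e (\<lambda>i. enc_list enc_nat (ys i))"
  shows "polytime D \<kappa> e (\<lambda>i. enc_bool (covered (J i) (xs i) (ys i)))"
  unfolding covered_def
proof (rule polytime_all[OF ys])
  fix e'
  let ?D = "SIGMA i:D. set (ys i)" and ?\<kappa> = "\<lambda>j. \<kappa> (fst j)"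
  assume u: "polytime ?D ?\<kappa> e' (\<lambda>j. enc_nat (snd j))"
    and up: "\<And>g. polytime D \<kappa> e g \<Longrightarrow> polytime ?D ?\<kappa> e' (\<lambda>j. g (fst j))"
  note pts = up[OF polytime_tagged_points[OF enc J]]
  show "polytime ?D ?\<kappa> e' (\<lambda>j. enc_bool (\<exists>p\<in>set (tagged_points (J (fst j))). \<exists>q\<in>set (tagged_points (J (fst j))).
      fst p = snd j \<and> fst q \<in> set (xs (fst j)) \<and> snd p = snd q))"
  proof (rule polytime_ex[OF pts])
    fix e''
    let ?E = "SIGMA j:?D. set (tagged_points (J (fst j)))" and ?\<kappa>' = "\<lambda>l. \<kappa> (fst (fst l))"
    assume p: "polytime ?E ?\<kappa>' e'' (\<lambda>l. enc_nat_pair (snd l))"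
      and up': "\<And>g. polytime ?D ?\<kappa> e' g \<Longrightarrow> polytime ?E ?\<kappa>' e'' (\<lambda>l. g (fst l))"
    show "polytime ?E ?\<kappa>' e'' (\<lambda>l. enc_bool (\<exists>q\<in>set (tagged_points (J (fst (fst l)))).
        fst (snd l) = snd (fst l) \<and> fst q \<in> set (xs (fst (fst l))) \<and> snd (snd l) = snd q))"
    proof (rule polytime_ex[OF up'[OF pts]])
      fix e3
      let ?G = "SIGMA l:?E. set (tagged_points (J (fst (fst l))))" and ?\<kappa>'' = "\<lambda>n. \<kappa> (fst (fst (fst n)))"
      assume q: "polytime ?G ?\<kappa>'' e3 (\<lambda>n. enc_nat_pair (snd n))"
        and up'': "\<And>g. polytime ?E ?\<kappa>' e'' g \<Longrightarrow> polytime ?G ?\<kappa>'' e3 (\<lambda>n. g (fst n))"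
      note p' = up''[OF p]
      show "polytime ?G ?\<kappa>'' e3 (\<lambda>n. enc_bool (fst (snd (fst n)) = snd (fst (fst n)) \<and>
          fst (snd n) \<in> set (xs (fst (fst (fst n)))) \<and> snd (snd (fst n)) = snd (snd n)))"
        by (rule polytime_conj'[OF polytime_nat_eq[OF polytime_fst[OF p'] up''[OF up'[OF u]]]
              polytime_conj'[OF polytime_member[OF polytime_fst[OF q] up''[OF up'[OF up[OF xs]]]]
                polytime_nat_eq[OF polytime_snd[OF p'] polytime_snd[OF q]]]])
    qed
  qed
qed

lemma polytime_prune:
  assumes enc: "polytime D \<kappa> e (\<lambda>i. enc_pcm R (J i))"
    and xs: "polytime D \<kappa> e (\<lambda>i. enc_list enc_nat (xs i))"
  shows "polytime D \<kappa> e (\<lambda>i. enc_list enc_nat (prune (J i) (xs i)))"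
  unfolding prune_def
proof (rule polytime_concat, rule polytime_map[OF polytime_facilities[OF enc]])
  fix e'
  let ?D = "SIGMA i:D. facility_set (J i)" and ?\<kappa> = "\<lambda>j. \<kappa> (fst j)"
  assume r: "polytime ?D ?\<kappa> e' (\<lambda>j. enc_nat (snd j))"
    and up: "\<And>g. polytime D \<kappa> e g \<Longrightarrow> polytime ?D ?\<kappa> e' (\<lambda>j. g (fst j))"
  show "polytime ?D ?\<kappa> e' (\<lambda>j. enc_list enc_nat
      (take 1 (filter (\<lambda>f. representative (J (fst j)) f = snd j) (xs (fst j)))))"
  proof (rule polytime_take_1, rule polytime_filter[OF up[OF xs]])
    fix e''
    let ?E = "SIGMA j:?D. set (xs (fst j))" and ?\<kappa>' = "\<lambda>l. \<kappa> (fst (fst l))"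
    assume f: "polytime ?E ?\<kappa>' e'' (\<lambda>l. enc_nat (snd l))"
      and up': "\<And>g. polytime ?D ?\<kappa> e' g \<Longrightarrow> polytime ?E ?\<kappa>' e'' (\<lambda>l. g (fst l))"
    show "polytime ?E ?\<kappa>' e'' (\<lambda>l. enc_bool (representative (J (fst (fst l))) (snd l) = snd (fst l)))"
      by (rule polytime_nat_eq[OF polytime_representative[OF up'[OF up[OF enc]] f] up'[OF r]])
  qed
qed

section \<open>The loop over all demands\<close>

lemma size_enc_list_mono:
  assumes "distinct xs" "distinct ys" "set xs \<subseteq> set ys"
  shows "size (enc_list e xs) \<le> size (enc_list e ys)"
proof -
  have "size (enc_list e zs) = (\<Sum>z\<in>set zs. Suc (size (e z)))" if "distinct zs" for zs
    unfolding size_enc_list by (rule sum_list_distinct_conv_sum_set[OF that])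
  with assms show ?thesis by (simp add: sum_mono2)
qed

lemma set_best_subset:
  assumes "\<And>m. m \<le> k \<Longrightarrow> distinct (fst (out m)) \<and> set (fst (out m)) \<subseteq> X"
  shows "distinct (best J out k) \<and> set (best J out k) \<subseteq> X"
  using assms by (induction k) auto

text \<open>Makes the largest time bound of a call positive, so that it is the \<open>Suc\<close> of
  a weight.\<close>

lemma runs_pos: "runs Q p x y t \<Longrightarrow> t > 0"
  by (induction rule: runs.induct) simp_all

text \<open>The answers of \<open>B\<close> are fixed beforehand as lists \<open>out i m\<close>.
  This makes \<open>best\<close> a plain function, and the loop only has to realise it.\<close>

lemma polytime_best:
  fixes J :: "'i \<Rightarrow> 'r pcm" and out :: "'i \<Rightarrow> nat \<Rightarrow> nat list \<times> nat list"
  assumes enc: "polytime D \<kappa> e (\<lambda>i. enc_pcm R (J i))"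
    and J: "\<And>i. i \<in> D \<Longrightarrow> pcm_instance R b (J i)"
    and run: "\<And>i m. i \<in> D \<Longrightarrow> m \<le> length (tags (J i)) \<Longrightarrow>
      \<exists>t. runs (answer (\<kappa> i)) B (enc_supplier R (supplier_of (J i) m))
        (Node (enc_list enc_nat (fst (out i m))) (enc_list enc_nat (snd (out i m)))) t \<and>
        t \<le> Suc (weight (\<kappa> i))"
    and out: "\<And>i m. i \<in> D \<Longrightarrow> m \<le> length (tags (J i)) \<Longrightarrow>
      distinct (fst (out i m)) \<and> distinct (snd (out i m)) \<and>
      set (fst (out i m)) \<subseteq> facility_set (J i) \<and>
      set (snd (out i m)) \<subseteq> client_set (supplier_of (J i) m)"
  shows "polytime D \<kappa> e (\<lambda>i. enc_list enc_nat (best (J i) (out i) (length (tags (J i)))))"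
proof -
  have F: "polytime D \<kappa> e (\<lambda>i. enc_list enc_nat (facilities (J i)))"
    by (rule polytime_facilities[OF enc])
  have tags: "polytime D \<kappa> e (\<lambda>i. enc_list enc_nat (tags (J i)))"
    by (rule polytime_tags[OF enc J])
  have tc: "polytime D \<kappa> e (\<lambda>i. enc_list enc_nat_pair (tagged_clients (J i)))"
    by (rule polytime_tagged_clients[OF enc J])
  have C: "polytime D \<kappa> e (\<lambda>i. enc_list enc_nat (map fst (tagged_clients (J i))))"
    by (rule polytime_map[OF tc]) (rule polytime_fst)
  \<comment> \<open>The list \<open>tags\<close> is a clock with one round per positive demand; the
    counter supplies the next demand \<open>Suc k\<close>.\<close>
  define s where "s i k = Node (enc_nat k) (enc_list enc_nat (best (J i) (out i) k))" for i k
  have "polytime D \<kappa> e (\<lambda>i. s i (length (tags (J i))))"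
  proof (rule polytime_iterate[OF tags])
    let ?D = "SIGMA i:D. {..length (tags (J i))}" and ?\<kappa> = "\<lambda>j. \<kappa> (fst j)"
    show "polytime D \<kappa> e (\<lambda>i. s i 0)"
      unfolding s_def using polytime_pair[OF polytime_const'[OF F] polytime_const'[OF F, of Leaf]] by simp
    have "poly_bounded ?D ?\<kappa> (\<lambda>j. 2 * length (tags (J (fst j))) +
        size (enc_list enc_nat (facilities (J (fst j)))) + 1)"
      by (intro poly_bounded_add poly_bounded_mult poly_bounded_const
          poly_bounded_reindex[OF polytime_length[OF tags]] poly_bounded_reindex[OF polytime_output[OF F]]) auto
    then show "poly_bounded ?D ?\<kappa> (\<lambda>j. size (s (fst j) (snd j)))"
    proof (rule poly_bounded_mono)
      fix j assume j: "j \<in> ?D"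
      obtain i k where ik: "j = (i, k)" "i \<in> D" "k \<le> length (tags (J i))"
        using j by auto
      have "distinct (best (J i) (out i) k) \<and> set (best (J i) (out i) k) \<subseteq> facility_set (J i)"
        using out[OF ik(2)] ik(3) by (intro set_best_subset) simp
      then have "size (enc_list enc_nat (best (J i) (out i) k)) \<le> size (enc_list enc_nat (facilities (J i)))"
        by (intro size_enc_list_mono distinct_facilities[OF J[OF ik(2)]]) simp_all
      moreover have "size (enc_nat k) \<le> 2 * length (tags (J i))"
        using size_enc_nat[of k] length_bits_le[of k] ik(3) by linarith
      ultimately show "size (s (fst j) (snd j)) \<le> 2 * length (tags (J (fst j))) +
          size (enc_list enc_nat (facilities (J (fst j)))) + 1"
        using ik(1) by (simp add: s_def)
    qed
  next
    fix e'
    let ?D = "SIGMA i:D. {..<length (tags (J i))}" and ?\<kappa> = "\<lambda>j. \<kappa> (fst j)"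
    let ?xs = "\<lambda>j. fst (out (fst j) (Suc (snd j)))" and ?ys = "\<lambda>j. snd (out (fst j) (Suc (snd j)))"
    assume s: "polytime ?D ?\<kappa> e' (\<lambda>j. s (fst j) (snd j))"
      and up: "\<And>g. polytime D \<kappa> e g \<Longrightarrow> polytime ?D ?\<kappa> e' (\<lambda>j. g (fst j))"
    note s1 = polytime_fst[OF s[unfolded s_def]] and s2 = polytime_snd[OF s[unfolded s_def]]
    have J': "pcm_instance R b (J (fst j))" if "j \<in> ?D" for j
      using that J by auto
    have m: "polytime ?D ?\<kappa> e' (\<lambda>j. enc_nat (Suc (snd j)))"
      by (rule polytime_Suc[OF s1])
    have I: "polytime ?D ?\<kappa> e' (\<lambda>j. enc_supplier R (supplier_of (J (fst j)) (Suc (snd j))))"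
      by (rule polytime_enc_supplier[OF up[OF enc] J' m])
    have "\<forall>j\<in>?D. \<exists>t. runs (answer (\<kappa> (fst j))) B (enc_supplier R (supplier_of (J (fst j)) (Suc (snd j))))
        (Node (enc_list enc_nat (?xs j)) (enc_list enc_nat (?ys j))) t \<and> t \<le> Suc (weight (\<kappa> (fst j)))"
      using run by auto
    then obtain t where t: "\<And>j. j \<in> ?D \<Longrightarrow> runs (answer (\<kappa> (fst j))) B
        (enc_supplier R (supplier_of (J (fst j)) (Suc (snd j))))
        (Node (enc_list enc_nat (?xs j)) (enc_list enc_nat (?ys j))) (t j)"
      "\<And>j. j \<in> ?D \<Longrightarrow> t j \<le> Suc (weight (\<kappa> (fst j)))"
      by metis
    \<comment> \<open>One call costs at most \<open>Suc\<close> of the weight, hence the constant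
      polynomial 1.\<close>
    have time: "time_bounded ?D ?\<kappa> t"
      unfolding time_bounded_def by (rule exI[of _ "[:1:]"]) (use t(2) in simp)
    \<comment> \<open>The size of an answer is not derived from the running time of
      \<open>B\<close>: lists of facilities or clients without repetitions are no larger than the
      full lists.\<close>
    have "poly_bounded ?D ?\<kappa> (\<lambda>j. size (enc_list enc_nat (facilities (J (fst j)))) +
        size (enc_list enc_nat (map fst (tagged_clients (J (fst j))))) + 1)"
      by (intro poly_bounded_add poly_bounded_const
          poly_bounded_reindex[OF polytime_output[OF C]] poly_bounded_reindex[OF polytime_output[OF F]]) auto
    then have size: "poly_bounded ?D ?\<kappa>
        (\<lambda>j. size (Node (enc_list enc_nat (?xs j)) (enc_list enc_nat (?ys j))))"
    proof (rule poly_bounded_mono)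
      fix j assume j: "j \<in> ?D"
      then have "fst j \<in> D" "Suc (snd j) \<le> length (tags (J (fst j)))" by auto
      from out[OF this] have "size (enc_list enc_nat (?xs j)) \<le> size (enc_list enc_nat (facilities (J (fst j))))"
        and "size (enc_list enc_nat (?ys j)) \<le> size (enc_list enc_nat (map fst (tagged_clients (J (fst j)))))"
        by (intro size_enc_list_mono distinct_facilities[OF J'[OF j]] distinct_clients[OF J'[OF j]]; simp)+
      then show "size (Node (enc_list enc_nat (?xs j)) (enc_list enc_nat (?ys j))) \<le>
          size (enc_list enc_nat (facilities (J (fst j)))) +
          size (enc_list enc_nat (map fst (tagged_clients (J (fst j))))) + 1"
        by simp
    qed
    have B: "polytime ?D ?\<kappa> e' (\<lambda>j. Node (enc_list enc_nat (?xs j)) (enc_list enc_nat (?ys j)))"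
      by (rule polytime_comp[OF I polytimeI[OF t(1) time polytime_output[OF I] size]])
    note xs = polytime_fst[OF B] and ys = polytime_snd[OF B]
    have "polytime ?D ?\<kappa> e' (\<lambda>j. if covered (J (fst j)) (?xs j) (?ys j)
        then enc_list enc_nat (?xs j) else enc_list enc_nat (best (J (fst j)) (out (fst j)) (snd j)))"
      by (rule polytime_if[OF polytime_covered[OF up[OF enc] J' xs ys]])
        (assumption | rule polytime_subset[OF xs] polytime_subset[OF s2], blast)+
    from polytime_pair[OF m this]
    show "polytime ?D ?\<kappa> e' (\<lambda>j. s (fst j) (Suc (snd j)))"
      by (rule polytime_cong) (simp add: s_def)
  qed
  from polytime_snd[OF this[unfolded s_def]] show ?thesis .
qed

section \<open>Assembling the algorithm and selecting the supplier instance\<close>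

theorem theorem2:
  fixes R :: "'r representation" and B :: prog and T\<^sub>B :: "nat \<Rightarrow> nat" and b :: "nat poly"
  assumes "nontrivial_approximation R B"
    and "supplier_runs_in_time R B T\<^sub>B"
  shows "\<exists>(A :: prog) (p :: nat poly) (q :: nat poly). \<forall>J :: 'r pcm. pcm_instance R b J \<longrightarrow>
    (\<exists>I :: 'r supplier. supplier_instance R I \<and>
       facilities I = facilities J \<and> family I = family J \<and>
       supplier_size R I \<le> poly q (pcm_size R J) \<and>
       solves_pcm_within R A J (poly p (pcm_size R J) * T\<^sub>B (supplier_size R I)))"
proof -
  from assms(1) obtain \<alpha> where \<alpha>: "\<And>I. supplier_instance R I \<Longrightarrow> \<exists>y z t S T.
      runs (reply R (family I)) B (enc_supplier R I) (Node y z) t \<and>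
      encodes_set y S \<and> encodes_set z T \<and> supplier_feasible R I S T \<and>
      supplier_cost I S T \<le> ennreal \<alpha> * supplier_opt R I"
    unfolding nontrivial_approximation_def by blast
  define D where "D = {J. pcm_instance R b J}"
  define cost where "cost J m = T\<^sub>B (supplier_size R (supplier_of J m))" for J :: "'r pcm" and m
  let ?good = "\<lambda>J m s. (\<exists>t. runs (reply R (family J)) B (enc_supplier R (supplier_of J m))
      (Node (enc_list enc_nat (fst s)) (enc_list enc_nat (snd s))) t \<and> t \<le> cost J m) \<and>
    distinct (fst s) \<and> distinct (snd s) \<and> supplier_feasible R (supplier_of J m) (set (fst s)) (set (snd s)) \<and>
    supplier_cost (supplier_of J m) (set (fst s)) (set (snd s)) \<le> ennreal \<alpha> * supplier_opt R (supplier_of J m)"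
  have "\<exists>s. ?good J m s" if "J \<in> D" "m \<le> length (tags J)" for J m
  proof -
    let ?I = "supplier_of J m"
    from that have inst: "supplier_instance R ?I"
      by (auto simp: D_def intro: supplier_instance_supplier_of)
    from \<alpha>[OF this] obtain y z t S T where r: "runs (reply R (family J)) B (enc_supplier R ?I) (Node y z) t"
      and S: "encodes_set y S" "encodes_set z T" "supplier_feasible R ?I S T"
        "supplier_cost ?I S T \<le> ennreal \<alpha> * supplier_opt R ?I"
      by auto
    from assms(2) inst obtain y' t' where "runs (reply R (family J)) B (enc_supplier R ?I) y' t'" "t' \<le> cost J m"
      unfolding supplier_runs_in_time_def cost_def by (metis supplier_of_simps(2))
    \<comment> \<open>Correctness and time bound come from separate hypotheses, each with a run of
      its own; determinism identifies the two runs.\<close>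
    with runs_deterministic[OF r] have "t \<le> cost J m" by metis
    moreover from S(1,2) obtain xs ys where "distinct xs" "set xs = S" "y = enc_list enc_nat xs"
      "distinct ys" "set ys = T" "z = enc_list enc_nat ys"
      unfolding encodes_set_def by metis
    ultimately have "?good J m (xs, ys)"
      using r S(3,4) by auto
    then show ?thesis by blast
  qed
  then obtain out where out: "\<And>J m. J \<in> D \<Longrightarrow> m \<le> length (tags J) \<Longrightarrow> ?good J m (out J m)"
    by metis
  \<comment> \<open>The price of the dearest call. The range contains demand 0, so the maximum is
    over a nonempty set.\<close>
  define w where "w J = Max (cost J ` {..length (tags J)})" for J
  have w: "cost J m \<le> w J" if "m \<le> length (tags J)" for J m
    unfolding w_def using that by (intro Max_ge) auto
  \<comment> \<open>Subtracting 1 undoes the \<open>Suc\<close> in \<open>time_bounded\<close>,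
    since the cost of every call is positive.\<close>
  define \<kappa> where "\<kappa> J = \<lparr>answer = reply R (family J), input_size = pcm_size R J, weight = w J - 1\<rparr>"
    for J :: "'r pcm"
  have enc: "polytime D \<kappa> (enc_pcm R) (\<lambda>J. enc_pcm R J)"
    using poly_bounded_size[of D \<kappa>] by (intro polytime_id) (simp add: \<kappa>_def pcm_size_def)
  have J: "pcm_instance R b J" if "J \<in> D" for J
    using that by (simp add: D_def)
  have tags: "polytime D \<kappa> (enc_pcm R) (\<lambda>J. enc_list enc_nat (tags J))"
    by (rule polytime_tags[OF enc J])
  let ?best = "\<lambda>J. best J (out J) (length (tags J))"
  have "polytime D \<kappa> (enc_pcm R) (\<lambda>J. enc_list enc_nat (?best J))"
  proof (rule polytime_best[OF enc J])
    fix J m assume Jm: "J \<in> D" "m \<le> length (tags J)"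
    show "\<exists>t. runs (answer (\<kappa> J)) B (enc_supplier R (supplier_of J m))
        (Node (enc_list enc_nat (fst (out J m))) (enc_list enc_nat (snd (out J m)))) t \<and> t \<le> Suc (weight (\<kappa> J))"
      using out[OF Jm] w[OF Jm(2)] by (fastforce simp: \<kappa>_def)
    show "distinct (fst (out J m)) \<and> distinct (snd (out J m)) \<and> set (fst (out J m)) \<subseteq> facility_set J \<and>
        set (snd (out J m)) \<subseteq> client_set (supplier_of J m)"
      using out[OF Jm] J[OF Jm(1)]
      by (auto simp: supplier_feasible_def pcm_instance_def down_closed_system_def)
  qed
  from polytime_prune[OF enc this] obtain A t where
    A: "\<And>J. J \<in> D \<Longrightarrow> runs (answer (\<kappa> J)) A (enc_pcm R J) (enc_list enc_nat (prune J (?best J))) (t J)"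
    and "time_bounded D \<kappa> t"
    unfolding polytime_def by blast
  then obtain P where P: "\<And>J. J \<in> D \<Longrightarrow> t J \<le> poly P (pcm_size R J) * Suc (w J - 1)"
    unfolding time_bounded_def \<kappa>_def by auto
  \<comment> \<open>One polynomial has to bound the supplier instances of all demands. Their
    construction is therefore indexed by \<open>(J, m)\<close>, with both encoded in the input, and
    \<open>polytime_output\<close> delivers \<open>q\<close>.\<close>
  let ?D = "SIGMA J:D. {..length (tags J)}" and ?e = "\<lambda>j. Node (enc_nat (snd j)) (enc_pcm R (fst j))"
    and ?\<kappa> = "\<lambda>j. \<kappa> (fst j)"
  have "poly_bounded ?D ?\<kappa> (\<lambda>j. 2 * length (tags (fst j)) + size (enc_pcm R (fst j)) + 1)"
    by (intro poly_bounded_add poly_bounded_mult poly_bounded_const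
        poly_bounded_reindex[OF polytime_length[OF tags]] poly_bounded_reindex[OF polytime_output[OF enc]]) auto
  then have "poly_bounded ?D ?\<kappa> (\<lambda>j. size (?e j))"
  proof (rule poly_bounded_mono)
    fix j assume "j \<in> ?D"
    then have "size (enc_nat (snd j)) \<le> 2 * length (tags (fst j))"
      using size_enc_nat[of "snd j"] length_bits_le[of "snd j"] by auto
    then show "size (?e j) \<le> 2 * length (tags (fst j)) + size (enc_pcm R (fst j)) + 1" by simp
  qed
  then have in_pair: "polytime ?D ?\<kappa> ?e ?e" by (rule polytime_id)
  have "polytime ?D ?\<kappa> ?e (\<lambda>j. enc_supplier R (supplier_of (fst j) (snd j)))"
    by (rule polytime_enc_supplier[OF polytime_snd[OF in_pair] _ polytime_fst[OF in_pair]]) (auto intro: J)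
  from polytime_output[OF this] obtain q where
    q: "\<And>J m. J \<in> D \<Longrightarrow> m \<le> length (tags J) \<Longrightarrow> supplier_size R (supplier_of J m) \<le> poly q (pcm_size R J)"
    unfolding poly_bounded_def \<kappa>_def supplier_size_def by force
  show ?thesis
  proof (rule exI[of _ A], rule exI[of _ P], rule exI[of _ q], intro allI impI)
    fix J :: "'r pcm" assume "pcm_instance R b J"
    then have JD: "J \<in> D" by (simp add: D_def)
    \<comment> \<open>The maximum is attained, and a demand attaining it determines the instance
      \<open>I\<close>: its time bound dominates those of all calls.\<close>
    have "w J \<in> cost J ` {..length (tags J)}"
      unfolding w_def by (intro Max_in) auto
    then obtain m where m: "m \<le> length (tags J)" "cost J m = w J" by auto
    have "cost J m > 0"
      using out[OF JD m(1)] runs_pos by (metis le_zero_eq not_gr_zero)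
    then have time: "t J \<le> poly P (pcm_size R J) * T\<^sub>B (supplier_size R (supplier_of J m))"
      using P[OF JD] m(2) by (simp add: cost_def del: mult_Suc_right)
    have "pcm_optimal R J (set (prune J (?best J)))"
      by (rule pcm_optimal_prune_best[OF J[OF JD], of _ \<alpha>]) (use out[OF JD] in blast)
    moreover have "encodes_set (enc_list enc_nat (prune J (?best J))) (set (prune J (?best J)))"
      using distinct_prune[OF J[OF JD]] unfolding encodes_set_def by blast
    ultimately have "solves_pcm_within R A J (poly P (pcm_size R J) * T\<^sub>B (supplier_size R (supplier_of J m)))"
      using A[OF JD] time unfolding solves_pcm_within_def \<kappa>_def by auto
    then show "\<exists>I :: 'r supplier. supplier_instance R I \<and> facilities I = facilities J \<and> family I = family J \<and>
        supplier_size R I \<le> poly q (pcm_size R J) \<and>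
        solves_pcm_within R A J (poly P (pcm_size R J) * T\<^sub>B (supplier_size R I))"
      using supplier_instance_supplier_of[OF J[OF JD] m(1)] q[OF JD m(1)]
      by (intro exI[of _ "supplier_of J m"]) simp
  qed
qed

end
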